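(* Let $X=B_\ell$ ($\ell\ge2$) or $X=C_\ell$ ($\ell\ge3$), and let $\nu,t,m_1,m_2$ be integers such that $7\le t+4\le m_1\le 2^t-1$ and $7\le\nu-t+4\le m_2\le2^{\nu-t}-1$. Then there exists an extended affine root system $R=R(X,S_1,S_2)$ of nullity $\nu$ and twist number $t$ with $$\mathrm{ind}(S_1)=\begin{cases}m_1&\text{if }X=B_\ell\ (\ell\ge2),\\2^t-1&\text{if }X=C_\ell\ (\ell\ge3),\end{cases}\qquad \mathrm{ind}(S_2)=\begin{cases}m_2&\text{if }X=B_2\text{ or }X=C_\ell\ (\ell\ge3),\\2^{\nu-t}-1&\text{if }X=B_\ell\ (\ell\ge3),\end{cases}$$ such that $R$ is not minimal.
   Context: A semilattice in a finite-dimensional real vector space $U$ is a discrete spanning subset $S\subseteq U$ with $0\in S$ and $S=S\pm2S$; $\langle S\rangle$ is its $\mathbb Z$-span, and $S$ is a lattice if $S=\langle S\rangle$. If $\sigma_1,\dots,\sigma_n\in S$ form a $\mathbb Z$-basis of $\langle S\rangle$ (such elements exist), $\mathrm{supp}(S)=\{J\subseteq\{1,\dots,n\}:\sum_{r\in J}\sigma_r\in S\}$ and $\mathrm{ind}(S)=|\mathrm{supp}(S)|-1$ (equivalently, $\mathrm{ind}(S)+1$ is the number of cosets of $2\langle S\rangle$ contained in $S$). A reduced extended affine root system of type $X=B_\ell$ ($\ell\ge2$) or $C_\ell$ ($\ell\ge3$), nullity $\nu$ and twist number $t$ is described as follows: $\mathcal V=\dot{\mathcal V}\oplus\mathcal V^0$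 is a real vector space with a positive semidefinite symmetric bilinear form with radical $\mathcal V^0=\mathcal V_1^0\oplus\mathcal V_2^0$, $\dim\mathcal V^0_1=t$, $\dim\mathcal V^0_2=\nu-t$; $\dot R=\{0\}\cup\dot R_{sh}\cup\dot R_{lg}$ is a finite root system of type $X$ spanning $\dot{\mathcal V}$ (short and long roots); $S_i$ is a semilattice in $\mathcal V_i^0$ ($i=1,2$), $S_2$ being a lattice if $X=B_\ell$ with $\ell\ge3$ and $S_1$ being a lattice if $X=C_\ell$ with $\ell\ge3$; with $S=S_1\oplus\langle S_2\rangle$, $R=R(X,S_1,S_2)=(S+S)\cup(\dot R_{sh}+S_1\oplus\langle S_2\rangle)\cup(\dot R_{lg}+2\langle S_1\rangle\oplus S_2)$. $R^\times=\{\alpha\in R:(\alpha,\alpha)\neq0\}$, $\alpha^\vee=2\alpha/(\alpha,\alpha)$. Let $\tilde{\mathcal V}=\mathcal V\oplus(\mathcal V^0)^*$ with the form extended by $(\dot\beta_1+\delta_1+\lambda_1,\dot\beta_2+\delta_2+\lambda_2)=(\dot\beta_1,\dot\beta_2)+\lambda_1(\delta_2)+\lambda_2(\delta_1)$ for $\dot\beta_i\in\dot{\mathcal V}$, $\delta_i\in\mathcal V^0$, $\lambda_i\in(\mathcal V^0)^*$. The Weyl group $\mathcal W$ is the subgroup of $GL(\tilde{\mathcal V})$ generated by $w_\alpha(u)=u-(u,\alpha^\vee)\alpha$, $\alpha\in R^\times$. $R$ is minimal if there is no $\alpha\in R^\times$ such that the reflections $w_\beta$, $\beta\in R^\times\setminus\mathcal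 W\alpha$, generate $\mathcal W$. *)

theory Defs
  imports "HOL-Analysis.Analysis" "HOL-Algebra.Generated_Groups"
begin

section \<open>Semilattices\<close>

definition int_span :: "'a::real_vector set \<Rightarrow> 'a set" where
  "int_span = module.span (\<lambda>k::int. scaleR (of_int k))"

definition int_independent :: "'a::real_vector set \<Rightarrow> bool" where
  "int_independent B \<longleftrightarrow> \<not> module.dependent (\<lambda>k::int. scaleR (of_int k)) B"

definition semilattice_set :: "'a::euclidean_space set \<Rightarrow> bool" where
  "semilattice_set S \<longleftrightarrow>
     discrete S \<and> span S = UNIV \<and> 0 \<in> S \<and>
     S = {s + 2 *\<^sub>R r | s r. s \<in> S \<and> r \<in> S} \<union> {s - 2 *\<^sub>R r | s r. s \<in> S \<and> r \<in> S}"

definition lattice_set :: "'a::euclidean_space set \<Rightarrow> bool" where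
  "lattice_set S \<longleftrightarrow> semilattice_set S \<and> S = int_span S"

definition int_basis_in :: "'a::real_vector set \<Rightarrow> 'a set \<Rightarrow> bool" where
  "int_basis_in S B \<longleftrightarrow> B \<subseteq> S \<and> int_independent B \<and> int_span B = int_span S"

text \<open>The basis is an unindexed set, so the support consists of subsets of the basis rather than
  of sets of indices.\<close>

definition supp :: "'a::real_vector set \<Rightarrow> 'a set \<Rightarrow> 'a set set" where
  "supp B S = {J. J \<subseteq> B \<and> \<Sum>J \<in> S}"

text \<open>The index of a semilattice does not depend on the chosen basis.\<close>

definition ind :: "'a::real_vector set \<Rightarrow> nat" where
  "ind S = card (supp (SOME B. int_basis_in S B) S) - 1"


section \<open>Finite root systems of type B and C\<close>

datatype root_type = B_type | C_type

text \<open>The standard realizations on a family \<open>e 0, \<dots>, e (l - 1)\<close>, with zero included.\<close>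

definition standard_roots :: "root_type \<Rightarrow> nat \<Rightarrow> (nat \<Rightarrow> 'd::euclidean_space) \<Rightarrow> 'd set" where
  "standard_roots X l e =
     {0} \<union>
     (\<Union>i<l. case X of B_type \<Rightarrow> {e i, - e i} | C_type \<Rightarrow> {2 *\<^sub>R e i, - (2 *\<^sub>R e i)}) \<union>
     (\<Union>i<l. \<Union>j<i. {e i + e j, e i - e j, - e i + e j, - e i - e j})"

text \<open>The inner product of the ambient space is the invariant form. It determines the irreducible
  root system only up to a scalar, hence the factor \<open>c\<close>.\<close>

definition finite_root_system_of_type :: "root_type \<Rightarrow> nat \<Rightarrow> 'd::euclidean_space set \<Rightarrow> bool" where
  "finite_root_system_of_type X l Rd \<longleftrightarrow>
     span Rd = UNIV \<and>
     (\<exists>e c. c > 0 \<and> (\<forall>i<l. \<forall>j<l. e i \<bullet> e j = (if i = j then c else 0)) \<and>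
        Rd = standard_roots X l e)"

definition short_roots :: "'d::euclidean_space set \<Rightarrow> 'd set" where
  "short_roots Rd = {\<alpha> \<in> Rd - {0}. \<forall>\<beta> \<in> Rd - {0}. norm \<alpha> \<le> norm \<beta>}"

definition long_roots :: "'d::euclidean_space set \<Rightarrow> 'd set" where
  "long_roots Rd = Rd - {0} - short_roots Rd"


section \<open>The hyperbolic extension and the extended affine root system\<close>

text \<open>An element \<open>(\<beta>, \<delta>, f)\<close> of the following type is the sum of \<open>\<beta>\<close> in the space of the finite
  root system, \<open>\<delta> = (x, y)\<close> in the radical, and \<open>f\<close> in the dual of the radical; every linear
  functional on the radical is bounded, as the dimension is finite. The space spanned by the
  extended affine root system is identified with the subspace \<open>f = 0\<close>.\<close>

type_synonym ('d, 'b, 'c) hyp_space = "'d \<times> ('b \<times> 'c) \<times> (('b \<times> 'c) \<Rightarrow>\<^sub>L real)"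

definition form :: "('d::euclidean_space, 'b::euclidean_space, 'c::euclidean_space) hyp_space
    \<Rightarrow> ('d, 'b, 'c) hyp_space \<Rightarrow> real" where
  "form u v = (case u of (\<beta>1, \<delta>1, f1) \<Rightarrow> case v of (\<beta>2, \<delta>2, f2) \<Rightarrow>
     \<beta>1 \<bullet> \<beta>2 + blinfun_apply f1 \<delta>2 + blinfun_apply f2 \<delta>1)"

definition ears_datum :: "root_type \<Rightarrow> nat \<Rightarrow> 'd::euclidean_space set
    \<Rightarrow> 'b::euclidean_space set \<Rightarrow> 'c::euclidean_space set \<Rightarrow> bool" where
  "ears_datum X l Rd S1 S2 \<longleftrightarrow>
     finite_root_system_of_type X l Rd \<and> semilattice_set S1 \<and> semilattice_set S2 \<and>
     (X = B_type \<and> l \<ge> 3 \<longrightarrow> lattice_set S2) \<and>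
     (X = C_type \<and> l \<ge> 3 \<longrightarrow> lattice_set S1)"

definition ears :: "'d::euclidean_space set \<Rightarrow> 'b::euclidean_space set \<Rightarrow> 'c::euclidean_space set
    \<Rightarrow> ('d, 'b, 'c) hyp_space set" where
  "ears Rd S1 S2 =
     {(0, \<sigma> + \<tau>, 0) | \<sigma> \<tau>. \<sigma> \<in> S1 \<times> int_span S2 \<and> \<tau> \<in> S1 \<times> int_span S2} \<union>
     {(\<alpha>, \<sigma>, 0) | \<alpha> \<sigma>. \<alpha> \<in> short_roots Rd \<and> \<sigma> \<in> S1 \<times> int_span S2} \<union>
     {(\<alpha>, \<sigma>, 0) | \<alpha> \<sigma>. \<alpha> \<in> long_roots Rd \<and> \<sigma> \<in> ((\<lambda>x. 2 *\<^sub>R x) ` int_span S1) \<times> S2}"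


section \<open>Weyl groups and minimality\<close>

definition nonisotropic :: "('d::euclidean_space, 'b::euclidean_space, 'c::euclidean_space) hyp_space set
    \<Rightarrow> ('d, 'b, 'c) hyp_space set" where
  "nonisotropic R = {\<alpha> \<in> R. form \<alpha> \<alpha> \<noteq> 0}"

definition coroot :: "('d::euclidean_space, 'b::euclidean_space, 'c::euclidean_space) hyp_space
    \<Rightarrow> ('d, 'b, 'c) hyp_space" where
  "coroot \<alpha> = (2 / form \<alpha> \<alpha>) *\<^sub>R \<alpha>"

definition reflection :: "('d::euclidean_space, 'b::euclidean_space, 'c::euclidean_space) hyp_space
    \<Rightarrow> ('d, 'b, 'c) hyp_space \<Rightarrow> ('d, 'b, 'c) hyp_space" where
  "reflection \<alpha> u = u - form u (coroot \<alpha>) *\<^sub>R \<alpha>"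

definition general_linear_group :: "('v::real_vector \<Rightarrow> 'v) monoid" where
  "general_linear_group = \<lparr>carrier = {f. linear f \<and> bij f}, mult = (\<circ>), one = id\<rparr>"

definition reflection_group :: "('d::euclidean_space, 'b::euclidean_space, 'c::euclidean_space) hyp_space set
    \<Rightarrow> (('d, 'b, 'c) hyp_space \<Rightarrow> ('d, 'b, 'c) hyp_space) set" where
  "reflection_group A = generate general_linear_group (reflection ` A)"

definition weyl_group :: "('d::euclidean_space, 'b::euclidean_space, 'c::euclidean_space) hyp_space set
    \<Rightarrow> (('d, 'b, 'c) hyp_space \<Rightarrow> ('d, 'b, 'c) hyp_space) set" where
  "weyl_group R = reflection_group (nonisotropic R)"

definition minimal :: "('d::euclidean_space, 'b::euclidean_space, 'c::euclidean_space) hyp_space set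
    \<Rightarrow> bool" where
  "minimal R \<longleftrightarrow>
     \<not> (\<exists>\<alpha> \<in> nonisotropic R.
          reflection_group (nonisotropic R - (\<lambda>w. w \<alpha>) ` weyl_group R) = weyl_group R)"

end

theory Submission
  imports Defs
begin

text \<open>
  The heart of the matter is a relation between reflections. For a root \<open>v\<close> of the finite root
  system and a vector \<open>x\<close> of the radical, let \<open>r(x)\<close> be the reflection in \<open>v + x\<close>. The products
  \<open>t(x) = r(x) r(0)\<close> are transvections, and up to a central, alternating and biadditive
  cocycle they are additive in \<open>x\<close>. The cocycle cancels in a suitable word (lemma
  \<open>reflection_seven\<close>):
  \<open>r(a + b + c) = r(a + b) r(b) r(b + c) r(c) r(0) r(a) r(a + c)\<close>.
  So the root \<open>v + a + b + c\<close> is redundant for generating the Weyl group as soon as the other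
  seven vertices \<open>v\<close>, \<open>v + a\<close>, and so on up to \<open>v + b + c\<close>, of the cube are roots that lie outside its
  orbit.

  The choice of the semilattices provides such cubes. Let \<open>\<Lambda>\<close> be the lattice spanned by the standard
  basis. A family \<open>F\<close> of subsets of the basis defines the union of those cosets of \<open>2 \<Lambda>\<close> that
  contain the sum of a member of \<open>F\<close>; when \<open>F\<close> contains the empty set and all singletons,
  this is a semilattice with span \<open>\<Lambda>\<close> and index \<open>card F - 1\<close>. Take \<open>F\<close> to contain
  also all subsets of some three basis vectors \<open>p\<close>, \<open>q\<close>, \<open>r\<close>. These are at most
  \<open>n + 5\<close> sets in dimension \<open>n\<close>, so that every index from \<open>n + 4\<close> to \<open>2 ^ n - 1\<close> occurs.
  Every vector in the coset of \<open>p + q + r\<close> is the sum \<open>a + b + c\<close> of vectors for which the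
  seven other partial sums lie in the semilattice, but in other cosets
  (lemma \<open>cube_decomposition\<close>).

  In type B the semilattice \<open>S1\<close> is chosen in this way and the short root over the coset of
  \<open>p + q + r\<close> is deleted; in type C the same is done with \<open>S2\<close> and a long root. The set of all
  short, respectively long, roots over this coset is stable under every reflection, because the
  relevant isotropic component only changes by elements of \<open>2 \<Lambda>\<close>. Hence it contains the
  Weyl group orbit of the deleted root, the cubes avoid that orbit, and all the deleted
  reflections are recovered.
\<close>

section \<open>Reflections\<close>

lemma reflection_apply:
  assumes "v \<noteq> 0"
  shows "reflection (v, \<delta>, 0) (w, \<eta>, f) =
    (w - (2 * (w \<bullet> v) / (v \<bullet> v) + 2 * blinfun_apply f \<delta> / (v \<bullet> v)) *\<^sub>R v,
     \<eta> - (2 * (w \<bullet> v) / (v \<bullet> v) + 2 * blinfun_apply f \<delta> / (v \<bullet> v)) *\<^sub>R \<delta>, f)"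
  by (simp add: reflection_def coroot_def form_def inner_commute blinfun.scaleR_right add_divide_distrib
      algebra_simps)

lemma reflection_involution:
  assumes "v \<noteq> 0"
  shows "reflection (v, \<delta>, 0) (reflection (v, \<delta>, 0) u) = u"
proof -
  obtain w \<eta> f where u: "u = (w, \<eta>, f)" by (metis prod.exhaust)
  define k where "k = 2 * (w \<bullet> v) / (v \<bullet> v) + 2 * blinfun_apply f \<delta> / (v \<bullet> v)"
  have "2 * ((w - k *\<^sub>R v) \<bullet> v) / (v \<bullet> v) + 2 * blinfun_apply f \<delta> / (v \<bullet> v) = - k"
    using assms by (simp add: k_def inner_diff_left diff_divide_distrib distrib_left)
  then show ?thesis
    by (simp add: u reflection_apply[OF assms] flip: k_def)
qed

lemma linear_reflection:
  assumes "v \<noteq> 0"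
  shows "linear (reflection (v, \<delta>, 0))"
proof (rule linearI)
  fix x y :: "('a, 'b, 'c) hyp_space" and r :: real
  obtain w \<eta> f where x: "x = (w, \<eta>, f)" by (metis prod.exhaust)
  obtain w' \<eta>' f' where y: "y = (w', \<eta>', f')" by (metis prod.exhaust)
  show "reflection (v, \<delta>, 0) (x + y) = reflection (v, \<delta>, 0) x + reflection (v, \<delta>, 0) y"
    using assms by (simp add: x y reflection_apply inner_add_left blinfun.add_left
        add_divide_distrib algebra_simps)
  show "reflection (v, \<delta>, 0) (r *\<^sub>R x) = r *\<^sub>R reflection (v, \<delta>, 0) x"
    using assms by (simp add: x reflection_apply blinfun.scaleR_left
        add_divide_distrib algebra_simps)
qed

text \<open>The word is found from \<open>t(x) t(y) = t(x + y) z(x, y)\<close> with \<open>t(x) = r(x) r(0)\<close> and \<open>z\<close> central,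
  alternating and biadditive. Then \<open>t(a + b) t(- b) t(b + c)\<close> is \<open>t(a + b + c)\<close> times the factor
  \<open>z(a, c)\<close>, which is also \<open>t(a) t(c) t(- a - c)\<close>; dividing and cancelling the squares of
  reflections leaves seven factors. The proof verifies the word directly: a reflection in
  \<open>v + x\<close> with \<open>x\<close> in the radical moves a vector only by a multiple of \<open>v\<close> and a vector of the radical,
  and does not change the form with vectors of the radical, so only the coefficient of \<open>v\<close> and the vector of the radical have to be tracked.\<close>

lemma reflection_seven:
  assumes v: "v \<noteq> 0"
  shows "reflection (v, a + b + c, 0) =
    reflection (v, a + b, 0) \<circ> reflection (v, b, 0) \<circ> reflection (v, b + c, 0) \<circ>
    reflection (v, c, 0) \<circ> reflection (v, 0, 0) \<circ> reflection (v, a, 0) \<circ> reflection (v, a + c, 0)"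
proof
  fix u :: "('a, 'b, 'c) hyp_space"
  obtain w \<eta> f where u: "u = (w, \<eta>, f)" by (metis prod.exhaust)
  define K where "K = 2 * (w \<bullet> v) / (v \<bullet> v)"
  define \<xi> where "\<xi> \<delta> = 2 * blinfun_apply f \<delta> / (v \<bullet> v)" for \<delta>
  have \<xi>_add: "\<xi> (\<delta> + \<delta>') = \<xi> \<delta> + \<xi> \<delta>'" and \<xi>_0: "\<xi> 0 = 0" for \<delta> \<delta>'
    by (simp_all add: \<xi>_def blinfun.add_right add_divide_distrib distrib_left)
  have step: "reflection (v, \<delta>, 0) (w - k *\<^sub>R v, \<eta> - y, f) = (w - k' *\<^sub>R v, \<eta> - y', f)"
    if "k' = K + \<xi> \<delta> - k" "y' = y + (k' - k) *\<^sub>R \<delta>" for \<delta> k k' y y'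
  proof -
    have eq: "2 * ((w - k *\<^sub>R v) \<bullet> v) / (v \<bullet> v) = K - 2 * k"
      using v by (simp add: K_def inner_diff_left diff_divide_distrib right_diff_distrib)
    show ?thesis
      unfolding reflection_apply[OF v] eq that \<xi>_def[symmetric]
      by (simp add: algebra_simps) (simp flip: scaleR_add_left)
  qed
  define A B C where "A = \<xi> a" and "B = \<xi> b" and "C = \<xi> c"
  note ABC = \<xi>_add \<xi>_0 A_def[symmetric] B_def[symmetric] C_def[symmetric]
  \<comment> \<open>\<open>y\<close> with index \<open>i\<close> is what has been subtracted from \<open>\<eta>\<close> after the first \<open>i\<close> reflections; the
    third reflection, in \<open>v\<close> itself, subtracts nothing.\<close>
  define y1 where "y1 = (K + A + C) *\<^sub>R (a + c)"
  define y2 where "y2 = y1 + (- K - A - 2 * C) *\<^sub>R a"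
  define y4 where "y4 = y2 + (- K - C) *\<^sub>R c"
  define y5 where "y5 = y4 + (K + B + C) *\<^sub>R (b + c)"
  define y6 where "y6 = y5 + (- K - B - 2 * C) *\<^sub>R b"
  have "reflection (v, a + b + c, 0) u =
      (w - (K + A + B + C) *\<^sub>R v, \<eta> - (K + A + B + C) *\<^sub>R (a + b + c), f)"
    using step[of _ "a + b + c" 0 _ 0] by (simp add: u ABC add.assoc)
  moreover have "reflection (v, a + c, 0) u = (w - (K + A + C) *\<^sub>R v, \<eta> - y1, f)"
    using step[of _ "a + c" 0 _ 0] by (simp add: u ABC y1_def add.assoc)
  moreover have "reflection (v, a, 0) (w - (K + A + C) *\<^sub>R v, \<eta> - y1, f) = (w - (- C) *\<^sub>R v, \<eta> - y2, f)"
    by (rule step) (simp_all add: ABC y2_def)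
  moreover have "reflection (v, 0, 0) (w - (- C) *\<^sub>R v, \<eta> - y2, f) = (w - (K + C) *\<^sub>R v, \<eta> - y2, f)"
    by (rule step) (simp_all add: ABC)
  moreover have "reflection (v, c, 0) (w - (K + C) *\<^sub>R v, \<eta> - y2, f) = (w - 0 *\<^sub>R v, \<eta> - y4, f)"
    by (rule step) (simp_all add: ABC y4_def)
  moreover have "reflection (v, b + c, 0) (w - 0 *\<^sub>R v, \<eta> - y4, f) = (w - (K + B + C) *\<^sub>R v, \<eta> - y5, f)"
    by (rule step) (simp_all add: ABC y5_def)
  moreover have "reflection (v, b, 0) (w - (K + B + C) *\<^sub>R v, \<eta> - y5, f) = (w - (- C) *\<^sub>R v, \<eta> - y6, f)"
    by (rule step) (simp_all add: ABC y6_def)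
  moreover have "reflection (v, a + b, 0) (w - (- C) *\<^sub>R v, \<eta> - y6, f) =
      (w - (K + A + B + C) *\<^sub>R v, \<eta> - (K + A + B + C) *\<^sub>R (a + b + c), f)"
  proof (rule step)
    show "K + A + B + C = K + \<xi> (a + b) - (- C)" by (simp add: ABC)
    show "(K + A + B + C) *\<^sub>R (a + b + c) = y6 + (K + A + B + C - (- C)) *\<^sub>R (a + b)"
      by (rule euclidean_eqI)
        (simp add: y6_def y5_def y4_def y2_def y1_def inner_add_left algebra_simps)
  qed
  ultimately show "reflection (v, a + b + c, 0) u =
    (reflection (v, a + b, 0) \<circ> reflection (v, b, 0) \<circ> reflection (v, b + c, 0) \<circ>
    reflection (v, c, 0) \<circ> reflection (v, 0, 0) \<circ> reflection (v, a, 0) \<circ> reflection (v, a + c, 0)) u"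
    by (simp only: o_apply)
qed

section \<open>Deleting a stable set of roots\<close>

lemma group_general_linear_group: "group general_linear_group"
proof (rule groupI)
  fix f :: "'v::real_vector \<Rightarrow> 'v"
  assume "f \<in> carrier general_linear_group"
  then have l: "linear f" and b: "bij f" by (auto simp: general_linear_group_def)
  then interpret linear f by simp
  have "linear (inv_into UNIV f)"
    by (rule linearI; rule inv_f_eq[OF bij_is_inj[OF b]])
      (simp_all add: add scale surj_f_inv_f[OF bij_is_surj[OF b]])
  with b show "\<exists>g\<in>carrier general_linear_group. mult general_linear_group g f = one general_linear_group"
    by (intro bexI[of _ "inv_into UNIV f"]) (auto simp: general_linear_group_def bij_is_inj bij_imp_bij_inv)
qed (auto simp: general_linear_group_def linear_compose bij_comp linear_id comp_assoc)

lemma reflection_in_carrier: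
  assumes "v \<noteq> 0"
  shows "reflection (v, \<delta>, 0) \<in> carrier general_linear_group"
  using linear_reflection[OF assms] involuntory_imp_bij[of "reflection (v, \<delta>, 0)", OF reflection_involution[OF assms]]
  by (simp add: general_linear_group_def)

lemma inv_reflection:
  assumes "v \<noteq> 0"
  shows "m_inv general_linear_group (reflection (v, \<delta>, 0)) = reflection (v, \<delta>, 0)"
proof (rule group.inv_equality[OF group_general_linear_group])
  show "mult general_linear_group (reflection (v, \<delta>, 0)) (reflection (v, \<delta>, 0)) = one general_linear_group"
    by (rule ext) (simp add: general_linear_group_def reflection_involution[OF assms] del: split_paired_All)
qed (rule reflection_in_carrier[OF assms])+

text \<open>Deleting the whole orbit of \<open>\<alpha>\<close> can be controlled without knowing the orbit: it is enough to have a
  set \<open>Q\<close> around \<open>\<alpha>\<close> that no reflection leaves and each of whose members completes a cube with its seven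
  other vertices outside \<open>Q\<close>.\<close>

lemma not_minimal_if_redundant:
  assumes R: "\<And>\<gamma>. \<gamma> \<in> nonisotropic R \<Longrightarrow> \<exists>v \<delta>. \<gamma> = (v, \<delta>, 0) \<and> v \<noteq> 0"
    and ne: "\<alpha> \<in> Q" "Q \<subseteq> nonisotropic R"
    and stable: "\<And>\<beta> \<gamma>. \<beta> \<in> Q \<Longrightarrow> \<gamma> \<in> nonisotropic R \<Longrightarrow> reflection \<gamma> \<beta> \<in> Q"
    and word: "\<And>\<beta>. \<beta> \<in> Q \<Longrightarrow> \<exists>v a b c. \<beta> = (v, a + b + c, 0) \<and>
      {(v, 0, 0), (v, a, 0), (v, b, 0), (v, c, 0), (v, a + b, 0), (v, a + c, 0), (v, b + c, 0)}
        \<subseteq> nonisotropic R - Q"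
  shows "\<not> minimal R"
proof -
  let ?G = "general_linear_group"
  let ?N = "nonisotropic R - (\<lambda>w. w \<alpha>) ` weyl_group R"
  let ?W = "reflection_group ?N"
  have refl: "reflection \<gamma> \<in> carrier ?G" "m_inv ?G (reflection \<gamma>) = reflection \<gamma>"
    if \<gamma>: "\<gamma> \<in> nonisotropic R" for \<gamma>
  proof -
    obtain v \<delta> where v: "\<gamma> = (v, \<delta>, 0)" "v \<noteq> 0" using R[OF \<gamma>] by (elim exE conjE)
    show "reflection \<gamma> \<in> carrier ?G" "m_inv ?G (reflection \<gamma>) = reflection \<gamma>"
      unfolding v(1) by (rule reflection_in_carrier[OF v(2)], rule inv_reflection[OF v(2)])
  qed
  have carrier: "reflection ` M \<subseteq> carrier ?G" if "M \<subseteq> nonisotropic R" for M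
    using refl(1) that by blast
  have "w \<beta> \<in> Q" if "w \<in> weyl_group R" "\<beta> \<in> Q" for w \<beta>
    using that unfolding weyl_group_def reflection_group_def
  proof (induction arbitrary: \<beta> rule: generate.induct)
    case one
    then show ?case by (simp add: general_linear_group_def)
  next
    case (incl h)
    then obtain \<gamma> where "\<gamma> \<in> nonisotropic R" "h = reflection \<gamma>" by blast
    with incl.prems show ?case by (simp only: stable)
  next
    case (inv h)
    then obtain \<gamma> where "\<gamma> \<in> nonisotropic R" "h = reflection \<gamma>" by blast
    with inv.prems show ?case by (simp only: refl(2) stable)
  next
    case (eng h1 h2)
    then show ?case by (simp add: general_linear_group_def)
  qed
  then have orbit: "nonisotropic R - Q \<subseteq> ?N" using ne by blast
  have sub: "subgroup ?W ?G"
    unfolding reflection_group_def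
    by (rule group.generate_is_subgroup[OF group_general_linear_group carrier]) blast
  have comp: "f \<circ> g \<in> ?W" if "f \<in> ?W" "g \<in> ?W" for f g
    using subgroup.m_closed[OF sub that] by (simp add: general_linear_group_def)
  have gen: "reflection \<gamma> \<in> ?W" if "\<gamma> \<in> nonisotropic R - Q" for \<gamma>
    unfolding reflection_group_def using orbit that by (blast intro: generate.incl)
  have "reflection \<gamma> \<in> ?W" if \<gamma>: "\<gamma> \<in> nonisotropic R" for \<gamma>
  proof (cases "\<gamma> \<in> Q")
    case False
    with \<gamma> show ?thesis by (intro gen DiffI)
  next
    case True
    then obtain v a b c where w: "\<gamma> = (v, a + b + c, 0)" 
      "{(v, 0, 0), (v, a, 0), (v, b, 0), (v, c, 0), (v, a + b, 0), (v, a + c, 0), (v, b + c, 0)}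
        \<subseteq> nonisotropic R - Q"
      using word[OF True] by (elim exE conjE)
    have "v \<noteq> 0" using R[OF \<gamma>] w(1) by blast
    then have "reflection \<gamma> = reflection (v, a + b, 0) \<circ> reflection (v, b, 0) \<circ> reflection (v, b + c, 0) \<circ>
        reflection (v, c, 0) \<circ> reflection (v, 0, 0) \<circ> reflection (v, a, 0) \<circ> reflection (v, a + c, 0)"
      unfolding w(1) by (rule reflection_seven)
    also have "\<dots> \<in> ?W"
      by (intro comp gen subsetD[OF w(2)]; simp only: insert_iff simp_thms)
    finally show ?thesis .
  qed
  then have "generate ?G (reflection ` nonisotropic R) \<subseteq> ?W"
    by (intro group.generate_subgroup_incl[OF group_general_linear_group _ sub] image_subsetI)
  then have "weyl_group R \<subseteq> ?W"
    by (simp only: weyl_group_def reflection_group_def)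
  moreover have "?W \<subseteq> weyl_group R"
    unfolding weyl_group_def reflection_group_def
    by (intro group.mono_generate[OF group_general_linear_group] image_mono Diff_subset)
  ultimately show ?thesis
    using ne unfolding minimal_def by (meson subset_antisym subsetD)
qed

section \<open>Semilattices with prescribed support\<close>

interpretation int_module: module "\<lambda>k::int. scaleR (of_int k) :: 'a::real_vector \<Rightarrow> 'a"
  by standard (simp_all add: algebra_simps)

definition int_lattice :: "'a::euclidean_space set" where
  "int_lattice = {x. \<forall>b\<in>Basis. x \<bullet> b \<in> \<int>}"

text \<open>This labels the cosets of twice the lattice: two lattice vectors are congruent if and only if the same
  coordinates are odd.\<close>

definition odd_support :: "'a::euclidean_space \<Rightarrow> 'a set" where
  "odd_support x = {b \<in> Basis. odd \<lfloor>x \<bullet> b\<rfloor>}"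

definition semilattice_of :: "'a::euclidean_space set set \<Rightarrow> 'a set" where
  "semilattice_of F = {x \<in> int_lattice. odd_support x \<in> F}"

text \<open>The last two conditions are \<open>0 \<in> S\<close> and \<open>Basis \<subseteq> S\<close> for the semilattice \<open>S\<close> with these cosets; the first one
  makes every member of \<open>F\<close> the label of a coset, so that distinct members are counted by the
  index.\<close>

definition support_family :: "'a::euclidean_space set set \<Rightarrow> bool" where
  "support_family F \<longleftrightarrow> F \<subseteq> Pow Basis \<and> {} \<in> F \<and> (\<forall>b\<in>Basis. {b} \<in> F)"

lemma int_lattice_coord:
  assumes "x \<in> int_lattice" "b \<in> Basis"
  obtains m where "x \<bullet> b = of_int m"
  using assms by (auto simp: int_lattice_def elim!: Ints_cases)

lemma int_lattice_add: "x \<in> int_lattice \<Longrightarrow> y \<in> int_lattice \<Longrightarrow> x + y \<in> int_lattice"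
  by (simp add: int_lattice_def inner_add_left)

lemma int_lattice_scale: "x \<in> int_lattice \<Longrightarrow> of_int k *\<^sub>R x \<in> int_lattice"
  by (simp add: int_lattice_def)

lemma int_lattice_diff: "x \<in> int_lattice \<Longrightarrow> y \<in> int_lattice \<Longrightarrow> x - y \<in> int_lattice"
  by (simp add: int_lattice_def inner_diff_left)

lemma zero_in_int_lattice: "0 \<in> int_lattice"
  by (simp add: int_lattice_def)

lemma Basis_subset_int_lattice: "Basis \<subseteq> int_lattice"
  by (auto simp: int_lattice_def inner_Basis)

lemma int_span_eq_int_lattice:
  assumes "Basis \<subseteq> S" "S \<subseteq> int_lattice"
  shows "int_span S = int_lattice"
proof
  show "int_span S \<subseteq> int_lattice"
    unfolding int_span_def
    by (rule int_module.span_minimal[OF assms(2)])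
      (auto simp: int_module.subspace_def int_lattice_add int_lattice_scale zero_in_int_lattice)
  show "int_lattice \<subseteq> int_span S"
  proof
    fix x :: 'a assume x: "x \<in> int_lattice"
    have "x = (\<Sum>b\<in>Basis. of_int \<lfloor>x \<bullet> b\<rfloor> *\<^sub>R b)"
      using x by (simp add: int_lattice_def euclidean_representation)
    also have "\<dots> \<in> int_span S"
      unfolding int_span_def using assms(1)
      by (intro int_module.span_sum int_module.span_scale int_module.span_base) auto
    finally show "x \<in> int_span S" .
  qed
qed

lemma int_independent_Basis: "int_independent (Basis :: 'a::euclidean_space set)"
  unfolding int_independent_def int_module.dependent_explicit
proof clarify
  fix t and u :: "'a \<Rightarrow> int" and v
  assume t: "finite t" "t \<subseteq> Basis" "(\<Sum>v\<in>t. of_int (u v) *\<^sub>R v) = 0" "v \<in> t" "u v \<noteq> 0"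
  have "0 = (\<Sum>v\<in>t. of_int (u v) *\<^sub>R v) \<bullet> v" using t by simp
  also have "\<dots> = (\<Sum>w\<in>t. if w = v then of_int (u v) else 0)"
    unfolding inner_sum_left using t by (intro sum.cong) (auto simp: inner_Basis subset_iff)
  finally show False using t by simp
qed

lemma odd_support_eqI:
  assumes "x \<in> int_lattice" "y \<in> int_lattice" "z \<in> int_lattice" "x = y + 2 *\<^sub>R z"
  shows "odd_support x = odd_support y"
proof -
  have "odd \<lfloor>x \<bullet> b\<rfloor> \<longleftrightarrow> odd \<lfloor>y \<bullet> b\<rfloor>" if b: "b \<in> Basis" for b
  proof -
    obtain m n where "y \<bullet> b = of_int m" "z \<bullet> b = of_int n"
      using assms(2,3) b by (metis int_lattice_coord)
    then have "x \<bullet> b = of_int (m + 2 * n)" "y \<bullet> b = of_int m" 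
      by (simp_all add: assms(4) inner_add_left)
    then show ?thesis by (simp only: floor_of_int) simp
  qed
  then show ?thesis by (auto simp: odd_support_def)
qed

lemma odd_support_eqD:
  assumes x: "x \<in> int_lattice" and y: "y \<in> int_lattice" and e: "odd_support x = odd_support y"
  obtains z where "z \<in> int_lattice" "x = y + 2 *\<^sub>R z"
proof
  show "x = y + 2 *\<^sub>R ((1/2) *\<^sub>R (x - y))" by simp
  show "(1/2) *\<^sub>R (x - y) \<in> int_lattice"
    unfolding int_lattice_def
  proof clarify
    fix b :: 'a assume b: "b \<in> Basis"
    obtain m n where mn: "x \<bullet> b = of_int m" "y \<bullet> b = of_int n"
      using x y b by (metis int_lattice_coord)
    have "odd m \<longleftrightarrow> odd n" using e b mn unfolding odd_support_def set_eq_iff mem_Collect_eq by (metis floor_of_int)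
    then have "even (m - n)" by simp
    then obtain k where "m - n = 2 * k" by blast
    then have "of_int m - of_int n = (2 * of_int k :: real)" by (metis of_int_diff of_int_mult of_int_numeral)
    then have "(1/2) *\<^sub>R (x - y) \<bullet> b = of_int k" using mn by (simp add: inner_diff_left)
    then show "(1/2) *\<^sub>R (x - y) \<bullet> b \<in> \<int>" by simp
  qed
qed

lemma sum_in_int_lattice: "J \<subseteq> int_lattice \<Longrightarrow> \<Sum>J \<in> int_lattice"
  by (induction J rule: infinite_finite_induct) (auto simp: int_lattice_add zero_in_int_lattice)

lemma odd_support_sum:
  assumes "J \<subseteq> Basis"
  shows "odd_support (\<Sum>J) = J"
proof -
  have "\<Sum>J \<bullet> b = (if b \<in> J then 1 else 0)" if b: "b \<in> Basis" for b :: 'a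
  proof -
    have "\<Sum>J \<bullet> b = (\<Sum>w\<in>J. if w = b then 1 else 0)"
      unfolding inner_sum_left using assms b by (intro sum.cong) (auto simp: inner_Basis)
    then show ?thesis using finite_subset[OF assms] by simp
  qed
  then show ?thesis using assms by (auto simp: odd_support_def split: if_splits)
qed

lemma Basis_subset_semilattice_of: 
  assumes "support_family F" 
  shows "Basis \<subseteq> semilattice_of F"
proof
  fix b :: 'a assume b: "b \<in> Basis"
  then have "odd_support b = {b}" using odd_support_sum[of "{b}"] by simp
  with b show "b \<in> semilattice_of F"
    using assms Basis_subset_int_lattice by (auto simp: semilattice_of_def support_family_def)
qed

lemma int_span_semilattice_of: "support_family F \<Longrightarrow> int_span (semilattice_of F) = int_lattice"
  by (intro int_span_eq_int_lattice Basis_subset_semilattice_of) (auto simp: semilattice_of_def)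

lemma discrete_subset_int_lattice: 
  assumes "S \<subseteq> int_lattice"
  shows "discrete S"
proof (rule uniform_discrete_imp_discrete)
  have "x = y" if "x \<in> S" "y \<in> S" "dist x y < 1" for x y
  proof (rule euclidean_eqI)
    fix b :: 'a assume b: "b \<in> Basis"
    have "x \<in> int_lattice" "y \<in> int_lattice" using that assms by auto
    with b obtain m n where mn: "x \<bullet> b = of_int m" "y \<bullet> b = of_int n"
      by (metis int_lattice_coord)
    have "\<bar>(x - y) \<bullet> b\<bar> < 1"
      using Basis_le_norm[OF b, of "x - y"] that by (simp add: dist_norm)
    then have "\<bar>of_int (m - n) :: real\<bar> < 1" using mn by (simp add: inner_diff_left)
    then have "m = n" by linarith
    then show "x \<bullet> b = y \<bullet> b" using mn by simp
  qed
  then show "uniform_discrete S" unfolding uniform_discrete_def by (intro exI[of _ 1]) auto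
qed

lemma semilattice_set_semilattice_of:
  assumes F: "support_family F"
  shows "semilattice_set (semilattice_of (F :: 'a::euclidean_space set set))"
proof -
  have closed: "s + 2 *\<^sub>R r \<in> semilattice_of F" "s - 2 *\<^sub>R r \<in> semilattice_of F"
    if "s \<in> semilattice_of F" "r \<in> semilattice_of F" for s r
  proof -
    have l: "s \<in> int_lattice" "r \<in> int_lattice" "odd_support s \<in> F"
      using that by (auto simp: semilattice_of_def)
    have mr: "-r \<in> int_lattice" using int_lattice_scale[OF l(2), of "-1"] by simp
    have rr: "2 *\<^sub>R r \<in> int_lattice" using int_lattice_scale[OF l(2), of 2] by simp
    have "odd_support (s + 2 *\<^sub>R r) = odd_support s" "odd_support (s - 2 *\<^sub>R r) = odd_support s"
      using odd_support_eqI[OF int_lattice_add[OF l(1) rr] l(1,2)]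
        odd_support_eqI[OF int_lattice_diff[OF l(1) rr] l(1) mr] by simp_all
    then show "s + 2 *\<^sub>R r \<in> semilattice_of F" "s - 2 *\<^sub>R r \<in> semilattice_of F"
      using l int_lattice_add[OF l(1) rr] int_lattice_diff[OF l(1) rr]
      by (simp_all add: semilattice_of_def)
  qed
  have zero: "0 \<in> semilattice_of F"
    using F odd_support_sum[of "{} :: 'a set"] by (simp add: semilattice_of_def support_family_def zero_in_int_lattice)
  have "span (semilattice_of F) = UNIV"
    using span_mono[OF Basis_subset_semilattice_of[OF F]] by auto
  moreover have "discrete (semilattice_of F)"
    by (rule discrete_subset_int_lattice) (auto simp: semilattice_of_def)
  moreover have "semilattice_of F =
      {s + 2 *\<^sub>R r |s r. s \<in> semilattice_of F \<and> r \<in> semilattice_of F} \<union>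
      {s - 2 *\<^sub>R r |s r. s \<in> semilattice_of F \<and> r \<in> semilattice_of F}" (is "_ = ?plus \<union> ?minus")
  proof
    show "semilattice_of F \<subseteq> ?plus \<union> ?minus"
    proof
      fix s assume "s \<in> semilattice_of F"
      with zero have "s \<in> ?plus" by (intro CollectI exI[of _ s] exI[of _ 0]) simp
      then show "s \<in> ?plus \<union> ?minus" ..
    qed
    show "?plus \<union> ?minus \<subseteq> semilattice_of F" by (auto simp: closed)
  qed
  ultimately show ?thesis
    unfolding semilattice_set_def using zero by (intro conjI)
qed

text \<open>The support is defined by sums over subsets of a basis, and sums over infinite sets are \<open>0\<close> by convention.
  So the index means what it should only for a finite basis.\<close>

lemma finite_int_basis:
  assumes B: "int_independent B" "int_span B = int_span C" and C: "finite C"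
  shows "finite B"
proof -
  have "\<exists>t. finite t \<and> t \<subseteq> B \<and> x \<in> int_span t" if "x \<in> int_span B" for x
  proof -
    have "\<exists>t r. x = (\<Sum>a\<in>t. of_int (r a) *\<^sub>R a) \<and> finite t \<and> t \<subseteq> B"
      using that unfolding int_span_def int_module.span_explicit by simp
    then obtain t r where t: "x = (\<Sum>a\<in>t. of_int (r a) *\<^sub>R a)" "finite t" "t \<subseteq> B"
      by (elim exE conjE)
    have "x \<in> int_span t" unfolding t(1) int_span_def 
      by (intro int_module.span_sum int_module.span_scale int_module.span_base)
    with t show ?thesis by blast
  qed
  moreover have "C \<subseteq> int_span B" unfolding B(2) unfolding int_span_def by (rule int_module.span_superset)
  ultimately have "\<forall>x\<in>C. \<exists>t. finite t \<and> t \<subseteq> B \<and> x \<in> int_span t" by blast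
  then obtain t where t: "\<And>x. x \<in> C \<Longrightarrow> finite (t x) \<and> t x \<subseteq> B \<and> x \<in> int_span (t x)" by metis
  define D where "D = (\<Union>x\<in>C. t x)"
  have D: "finite D" "D \<subseteq> B" using t C by (auto simp: D_def)
  have "C \<subseteq> int_span D"
  proof
    fix x assume "x \<in> C"
    then have "x \<in> int_span (t x)" "t x \<subseteq> D" using t by (auto simp: D_def)
    then show "x \<in> int_span D"
      using int_module.span_mono[of "t x" D] unfolding int_span_def by blast
  qed
  then have "int_span B \<subseteq> int_span D"
    unfolding B(2) unfolding int_span_def by (rule int_module.span_minimal) (rule int_module.subspace_span)
  then have BD: "B \<subseteq> int_span D"
    using int_module.span_superset[of B] unfolding int_span_def by blast
  have "B \<subseteq> D"
  proof (rule ccontr)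
    assume "\<not> B \<subseteq> D"
    then obtain b where b: "b \<in> B" "b \<notin> D" by blast
    have "b \<in> range (\<lambda>u. \<Sum>a\<in>D. of_int (u a) *\<^sub>R a)"
      using BD b(1) unfolding int_span_def int_module.span_finite[OF D(1)] by (rule subsetD)
    then obtain u where u: "b = (\<Sum>a\<in>D. of_int (u a) *\<^sub>R a)" by (elim rangeE)
    have "(\<Sum>a\<in>insert b D. of_int ((u(b := -1)) a) *\<^sub>R a) = - b + (\<Sum>a\<in>D. of_int ((u(b := -1)) a) *\<^sub>R a)"
      using D b by simp
    also have "(\<Sum>a\<in>D. of_int ((u(b := -1)) a) *\<^sub>R a) = b"
      by (subst u, rule sum.cong) (use b in auto)
    finally have "(\<Sum>a\<in>insert b D. of_int ((u(b := -1)) a) *\<^sub>R a) = 0" by simp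
    then have "(u(b := -1)) b = 0"
      using B(1) D b unfolding int_independent_def
      by (intro int_module.independentD[of B "insert b D" "u(b := -1)" b]) auto
    then show False by simp
  qed
  with D show ?thesis using finite_subset by blast
qed

text \<open>For every \<open>\<int>\<close>-basis \<open>B\<close> of the lattice, the sums of the subsets of \<open>B\<close> represent each
  coset of twice the lattice exactly once. The support with respect to \<open>B\<close> therefore counts the cosets in the
  semilattice, and these are labelled by \<open>F\<close>.\<close>

lemma card_supp_semilattice_of:
  assumes F: "support_family F" and B: "int_basis_in (semilattice_of F) B"
  shows "card (supp B (semilattice_of F)) = card F"
proof (rule bij_betw_same_card)
  let ?S = "semilattice_of F"
  have span: "int_span B = int_lattice" and ind: "int_independent B" and BS: "B \<subseteq> ?S"
    using B int_span_semilattice_of[OF F] by (auto simp: int_basis_in_def)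
  have BL: "B \<subseteq> int_lattice" using BS by (auto simp: semilattice_of_def)
  have fin: "finite B"
  proof (rule finite_int_basis[OF ind _ finite_Basis])
    show "int_span B = int_span Basis"
      unfolding span by (rule int_span_eq_int_lattice[OF order_refl Basis_subset_int_lattice, symmetric])
  qed
  have repr: "\<exists>n. x = (\<Sum>b\<in>B. of_int (n b) *\<^sub>R b)" if "x \<in> int_lattice" for x
    using that unfolding span[symmetric] unfolding int_span_def int_module.span_finite[OF fin] by (elim rangeE exI)
  have sumJ: "\<Sum>J = (\<Sum>b\<in>B. of_int (of_bool (b \<in> J)) *\<^sub>R b)" if "J \<subseteq> B" for J
  proof -
    have "(\<Sum>b\<in>B. of_int (of_bool (b \<in> J)) *\<^sub>R b) = (\<Sum>b\<in>B. if b \<in> J then b else 0)"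
      by (rule sum.cong) auto
    also have "\<dots> = \<Sum>(B \<inter> J)" by (rule sum.inter_restrict[OF fin, symmetric])
    finally show ?thesis using that by (simp add: Int_absorb1)
  qed
  show "bij_betw (\<lambda>J. odd_support (\<Sum>J)) (supp B ?S) F"
    unfolding bij_betw_def
  proof
    show "inj_on (\<lambda>J. odd_support (\<Sum>J)) (supp B ?S)"
    proof (rule inj_onI)
      fix J K assume J: "J \<in> supp B ?S" and K: "K \<in> supp B ?S" 
        and eq: "odd_support (\<Sum>J) = odd_support (\<Sum>K)"
      have JK: "J \<subseteq> B" "K \<subseteq> B" "\<Sum>J \<in> int_lattice" "\<Sum>K \<in> int_lattice"
        using J K by (auto simp: supp_def semilattice_of_def)
      obtain z where z: "z \<in> int_lattice" "\<Sum>J = \<Sum>K + 2 *\<^sub>R z"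
        using odd_support_eqD[OF JK(3,4) eq] .
      obtain n where n: "z = (\<Sum>b\<in>B. of_int (n b) *\<^sub>R b)" using repr[OF z(1)] by blast
      \<comment> \<open>The coefficients of the linear relation that expresses the congruence of the two sums.\<close>
      define u where "u b = of_bool (b \<in> J) - of_bool (b \<in> K) - 2 * n b" for b
      have "(\<Sum>b\<in>B. of_int (u b) *\<^sub>R b) = \<Sum>J - \<Sum>K - 2 *\<^sub>R z"
        unfolding sumJ[OF JK(1)] sumJ[OF JK(2)] n u_def
        by (simp add: sum_subtractf scaleR_sum_right scaleR_left_diff_distrib)
      then have "(\<Sum>b\<in>B. of_int (u b) *\<^sub>R b) = 0" using z by simp
      then have u0: "u b = 0" if "b \<in> B" for b
        using int_module.independentD[of B B u b] ind fin that unfolding int_independent_def by auto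
      have "b \<in> J \<longleftrightarrow> b \<in> K" if "b \<in> B" for b
      proof -
        have "of_bool (b \<in> J) - of_bool (b \<in> K) = 2 * n b" using u0[OF that] by (simp add: u_def)
        then show ?thesis by (cases "b \<in> J"; cases "b \<in> K") (auto; presburger)+
      qed
      then show "J = K" using JK by blast
    qed
    show "(\<lambda>J. odd_support (\<Sum>J)) ` supp B ?S = F"
    proof
      show "(\<lambda>J. odd_support (\<Sum>J)) ` supp B ?S \<subseteq> F"
        by (auto simp: supp_def semilattice_of_def)
      show "F \<subseteq> (\<lambda>J. odd_support (\<Sum>J)) ` supp B ?S"
      proof
        fix P assume P: "P \<in> F"
        then have PB: "P \<subseteq> Basis" using F by (auto simp: support_family_def)
        then have PL: "\<Sum>P \<in> int_lattice" 
          using sum_in_int_lattice Basis_subset_int_lattice by blast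
        obtain n where n: "\<Sum>P = (\<Sum>b\<in>B. of_int (n b) *\<^sub>R b)" using repr[OF PL] by blast
        define J where "J = {b \<in> B. odd (n b)}"
        define z where "z = (\<Sum>b\<in>B. of_int (n b div 2) *\<^sub>R b)"
        have "\<Sum>J + 2 *\<^sub>R z = (\<Sum>b\<in>B. of_int (of_bool (b \<in> J) + 2 * (n b div 2)) *\<^sub>R b)"
          unfolding z_def by (subst sumJ) (auto simp: J_def sum.distrib scaleR_sum_right scaleR_left_distrib)
        also have "\<dots> = \<Sum>P" unfolding n
        proof (rule sum.cong[OF refl])
          fix b assume "b \<in> B"
          then have "of_bool (b \<in> J) = n b mod 2" by (simp add: J_def mod_2_eq_odd)
          then have "of_bool (b \<in> J) + 2 * (n b div 2) = n b" by simp
          then show "of_int (of_bool (b \<in> J) + 2 * (n b div 2)) *\<^sub>R b = of_int (n b) *\<^sub>R b"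
            by (simp only:)
        qed
        finally have e: "\<Sum>P = \<Sum>J + 2 *\<^sub>R z" by simp
        have zL: "z \<in> int_lattice" unfolding z_def span[symmetric] int_span_def
          by (intro int_module.span_sum int_module.span_scale int_module.span_base)
        have JL: "\<Sum>J \<in> int_lattice" using BL by (intro sum_in_int_lattice) (auto simp: J_def)
        have "odd_support (\<Sum>J) = P"
          using odd_support_eqI[OF PL JL zL e] odd_support_sum[OF PB] by simp
        then show "P \<in> (\<lambda>J. odd_support (\<Sum>J)) ` supp B ?S"
          using P JL by (auto simp: supp_def semilattice_of_def J_def intro!: image_eqI[of _ _ J])
      qed
    qed
  qed
qed

lemma ind_semilattice_of:
  assumes "support_family F"
  shows "ind (semilattice_of F) = card F - 1"
proof -
  have "int_basis_in (semilattice_of F) Basis"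
    using assms int_span_eq_int_lattice[of Basis] 
    by (simp add: int_basis_in_def Basis_subset_semilattice_of int_independent_Basis
        int_span_semilattice_of Basis_subset_int_lattice)
  then have "int_basis_in (semilattice_of F) (SOME B. int_basis_in (semilattice_of F) B)"
    by (rule someI)
  then show ?thesis using card_supp_semilattice_of[OF assms] by (simp add: ind_def)
qed

lemma semilattice_of_in_int_lattice: "x \<in> semilattice_of F \<Longrightarrow> x \<in> int_lattice"
  by (simp add: semilattice_of_def)

lemma semilattice_of_Pow: "semilattice_of (Pow Basis) = int_lattice"
  by (auto simp: semilattice_of_def odd_support_def)

lemma support_family_Pow: "support_family (Pow Basis)"
  by (auto simp: support_family_def)

lemma lattice_set_Pow: "lattice_set (semilattice_of (Pow Basis))"
  unfolding lattice_set_def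
proof
  show "semilattice_set (semilattice_of (Pow Basis))"
    by (rule semilattice_set_semilattice_of[OF support_family_Pow])
  show "semilattice_of (Pow Basis) = int_span (semilattice_of (Pow Basis))"
    unfolding int_span_semilattice_of[OF support_family_Pow] by (rule semilattice_of_Pow)
qed

lemma ind_Pow: "ind (semilattice_of (Pow Basis :: 'a::euclidean_space set set)) = 2 ^ DIM('a) - 1"
  by (simp add: ind_semilattice_of support_family_Pow card_Pow)

text \<open>The eight subset sums of \<open>p\<close>, \<open>q\<close>, \<open>r\<close> are the vertices of a cube in the semilattice.\<close>

definition has_cube :: "'a set set \<Rightarrow> 'a \<Rightarrow> 'a \<Rightarrow> 'a \<Rightarrow> bool" where
  "has_cube F p q r \<longleftrightarrow> distinct [p, q, r] \<and> Pow {p, q, r} \<subseteq> F"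

text \<open>The empty set, the singletons, the three pairs from a triple and the triple itself are \<open>DIM('a) + 5\<close> sets, and the
  index is one less than the number of cosets; this is where the lower bound for \<open>m\<close> comes from.\<close>

lemma exists_support_family:
  assumes "3 \<le> DIM('a::euclidean_space)" "DIM('a) + 4 \<le> m" "m \<le> 2 ^ DIM('a) - 1"
  obtains F :: "'a::euclidean_space set set" and p q r
  where "support_family F" "card F = m + 1" "has_cube F p q r"
proof -
  obtain T :: "'a set" where T: "T \<subseteq> Basis" "card T = 3"
    using assms(1) obtain_subset_with_card_n by metis
  then obtain p q r where pqr: "T = {p, q, r}" "p \<noteq> q" "q \<noteq> r" "p \<noteq> r"
    by (auto simp: card_3_iff)
  define A where "A = insert {} ((\<lambda>b. {b}) ` Basis \<union> {{p,q}, {p,r}, {q,r}, {p,q,r}})"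
  have "card ((\<lambda>b. {b}) ` (Basis :: 'a set)) \<le> DIM('a)" by (simp add: card_image_le)
  moreover have "card {{p,q}, {p,r}, {q,r}, {p,q,r}} \<le> 4"
    using card_length[of "[{p,q}, {p,r}, {q,r}, {p,q,r}]"] by simp
  ultimately have "card ((\<lambda>b. {b}) ` Basis \<union> {{p,q}, {p,r}, {q,r}, {p,q,r}}) \<le> DIM('a) + 4"
    using card_Un_le[of "(\<lambda>b. {b}) ` Basis" "{{p,q}, {p,r}, {q,r}, {p,q,r}}"] by linarith
  then have cA: "card A \<le> m + 1"
    unfolding A_def using assms(2) by (simp add: card_insert_if)
  have AP: "A \<subseteq> Pow Basis" using T pqr by (auto simp: A_def)
  have "m + 1 \<le> card (Pow (Basis :: 'a set))"
    using assms(3) by (simp add: card_Pow) (metis One_nat_def Suc_le_eq Suc_pred le_imp_less_Suc pos2 zero_less_power)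
  then obtain F where F: "A \<subseteq> F" "F \<subseteq> Pow Basis" "card F = m + 1"
    using exists_subset_between[OF cA _ AP] by auto
  have "support_family F" using F by (auto simp: support_family_def A_def)
  moreover have "Pow {p, q, r} \<subseteq> A"
    using T pqr by (auto simp: A_def Pow_insert)
  then have "has_cube F p q r"
    using F pqr by (auto simp: has_cube_def)
  ultimately show ?thesis using F that by blast
qed

text \<open>A reflection moves the lattice component that decides membership in the deleted coset by an even multiple of a
  lattice vector, or by an integer multiple of twice a lattice vector; both have this form.\<close>

lemma odd_support_shift:
  assumes x: "x \<in> int_lattice" and z: "z \<in> int_lattice"
  shows "x - (2 * of_int m) *\<^sub>R z \<in> int_lattice"
    and "odd_support (x - (2 * of_int m) *\<^sub>R z) = odd_support x"
proof -
  show l: "x - (2 * of_int m) *\<^sub>R z \<in> int_lattice"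
    using int_lattice_diff[OF x int_lattice_scale[OF z, of "2 * m"]] by simp
  show "odd_support (x - (2 * of_int m) *\<^sub>R z) = odd_support x"
    by (rule odd_support_eqI[OF l x int_lattice_scale[OF z, of "- m"]]) simp
qed

text \<open>Modulo twice the lattice, \<open>x\<close> is \<open>p + q + r\<close>. Moving the difference into the summand of \<open>p\<close> turns this congruence
  into an equality, and the partial sums stay in the cosets of the proper subsets of the triple.\<close>

lemma cube_decomposition:
  assumes F: "support_family F" "has_cube F p q r"
    and x: "x \<in> int_lattice" "odd_support x = {p, q, r}"
  obtains a b c where "x = a + b + c"
    "{0, a, b, c, a + b, a + c, b + c} \<subseteq> semilattice_of F - {z. odd_support z = {p, q, r}}"
proof -
  have d: "p \<noteq> q" "p \<noteq> r" "q \<noteq> r" and sub: "Pow {p, q, r} \<subseteq> F"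
    using F(2) by (auto simp: has_cube_def)
  have B: "p \<in> Basis" "q \<in> Basis" "r \<in> Basis"
    using F(1) sub by (auto simp: support_family_def)
  have mem: "\<Sum>J + 2 *\<^sub>R z \<in> semilattice_of F - {z. odd_support z = {p, q, r}}"
    if J: "J \<subset> {p, q, r}" and z: "z \<in> int_lattice" for J z
  proof -
    have JB: "J \<subseteq> Basis" using J B by blast
    then have JL: "\<Sum>J \<in> int_lattice" using sum_in_int_lattice Basis_subset_int_lattice by blast
    have L: "\<Sum>J + 2 *\<^sub>R z \<in> int_lattice"
      using int_lattice_add[OF JL int_lattice_scale[OF z, of 2]] by simp
    have "odd_support (\<Sum>J + 2 *\<^sub>R z) = J"
      using odd_support_eqI[OF L JL z] odd_support_sum[OF JB] by simp
    then show ?thesis using L J sub by (auto simp: semilattice_of_def)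
  qed
  have "\<Sum>{p, q, r} \<in> int_lattice" "odd_support (\<Sum>{p, q, r}) = {p, q, r}"
    using B by (intro sum_in_int_lattice odd_support_sum; use Basis_subset_int_lattice in blast)+
  then obtain z where z: "z \<in> int_lattice" "x = \<Sum>{p, q, r} + 2 *\<^sub>R z"
    using odd_support_eqD[OF x(1)] x(2) by metis
  have pq: "{p, q} \<subset> {p, q, r}" and pr: "{p, r} \<subset> {p, q, r}" and qr: "{q, r} \<subset> {p, q, r}"
    using d by auto
  note mem0 = mem[OF _ zero_in_int_lattice]
  have "{0, p + 2 *\<^sub>R z, q, r, (p + 2 *\<^sub>R z) + q, (p + 2 *\<^sub>R z) + r, q + r}
      \<subseteq> semilattice_of F - {z. odd_support z = {p, q, r}}"
    unfolding insert_subset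
  proof (intro conjI empty_subsetI)
    show "0 \<in> semilattice_of F - {z. odd_support z = {p, q, r}}" using mem0[of "{}"] by auto
    show "p + 2 *\<^sub>R z \<in> semilattice_of F - {z. odd_support z = {p, q, r}}"
      using mem[OF _ z(1), of "{p}"] d by auto
    show "q \<in> semilattice_of F - {z. odd_support z = {p, q, r}}" using mem0[of "{q}"] d by auto
    show "r \<in> semilattice_of F - {z. odd_support z = {p, q, r}}" using mem0[of "{r}"] d by auto
    show "(p + 2 *\<^sub>R z) + q \<in> semilattice_of F - {z. odd_support z = {p, q, r}}"
      using mem[OF pq z(1)] d by (simp add: add_ac)
    show "(p + 2 *\<^sub>R z) + r \<in> semilattice_of F - {z. odd_support z = {p, q, r}}"
      using mem[OF pr z(1)] d by (simp add: add_ac)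
    show "q + r \<in> semilattice_of F - {z. odd_support z = {p, q, r}}" using mem0[OF qr] d by simp
  qed
  moreover have "x = (p + 2 *\<^sub>R z) + q + r" using d z(2) by (simp add: add_ac)
  ultimately show ?thesis by (rule that[rotated])
qed

section \<open>Root systems of type B and C in coordinates\<close>

text \<open>The vectors \<open>\<plusminus> e\<^sub>i\<close> are the short roots in type B, and doubled they are the long roots in type C. The other
  roots are the \<open>\<plusminus> e\<^sub>i \<plusminus> e\<^sub>j\<close> defined below.\<close>

definition unit_roots :: "'d::euclidean_space set" where
  "unit_roots = Basis \<union> uminus ` Basis"

definition pair_roots :: "'d::euclidean_space set" where
  "pair_roots = {x + y | x y. x \<in> unit_roots \<and> y \<in> unit_roots \<and> x \<bullet> y = 0}"

lemma inner_unit_roots: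
  assumes "x \<in> unit_roots" "y \<in> unit_roots"
  obtains "x = y" "x \<bullet> y = 1" | "x = - y" "x \<bullet> y = - 1" | "x \<bullet> y = 0"
proof -
  have "(x = y \<and> x \<bullet> y = 1) \<or> (x = - y \<and> x \<bullet> y = - 1) \<or> x \<bullet> y = 0"
    using assms by (auto simp: unit_roots_def inner_Basis split: if_split_asm)
  then show ?thesis using that by blast
qed

lemma inner_self_unit_root: "x \<in> unit_roots \<Longrightarrow> x \<bullet> x = 1"
  by (auto simp: unit_roots_def)

lemma inner_self_pair_root: "x \<in> pair_roots \<Longrightarrow> x \<bullet> x = 2"
  by (auto simp: pair_roots_def inner_self_unit_root inner_simps inner_commute)

lemma uminus_unit_root: "x \<in> unit_roots \<Longrightarrow> - x \<in> unit_roots"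
  by (auto simp: unit_roots_def)

text \<open>Together with the next lemma: reflections permute the vectors \<open>\<plusminus> e\<^sub>i\<close>, and the multiple of the root that is
  subtracted is even for a root \<open>\<plusminus> e\<^sub>j\<close>, but only integral for a root \<open>\<plusminus> e\<^sub>j \<plusminus> e\<^sub>k\<close>. The parity decides whether the
  isotropic part of that root may be an arbitrary lattice vector.\<close>

lemma reflect_unit_in_unit:
  assumes v: "v \<in> unit_roots" and w: "w \<in> unit_roots"
  obtains m where "v \<bullet> w = of_int m" "v - (2 * of_int m) *\<^sub>R w \<in> unit_roots"
  using v w
proof (cases rule: inner_unit_roots)
  case 1
  then show ?thesis using that[of 1] v uminus_unit_root[OF v] by (simp add: scaleR_2)
next
  case 2
  then show ?thesis using that[of "-1"] v w by (simp add: scaleR_2)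
next
  case 3
  then show ?thesis using that[of 0] v by simp
qed

lemma reflect_unit_in_pair:
  assumes v: "v \<in> unit_roots" and w: "w \<in> pair_roots"
  obtains m where "v \<bullet> w = of_int m" "v - of_int m *\<^sub>R w \<in> unit_roots"
proof -
  obtain x y where xy: "w = x + y" "x \<in> unit_roots" "y \<in> unit_roots" "x \<bullet> y = 0"
    using w by (auto simp: pair_roots_def)
  have *: "\<exists>m. v \<bullet> (x + y) = of_int m \<and> v - of_int m *\<^sub>R (x + y) \<in> unit_roots"
    if x: "x \<in> unit_roots" and y: "y \<in> unit_roots" and "x \<bullet> y = 0" "v \<bullet> x \<noteq> 0" for x y
    using v x
  proof (cases rule: inner_unit_roots)
    case 1
    then show ?thesis using that uminus_unit_root[OF y]
      by (intro exI[of _ 1]) (simp add: inner_add_right)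
  next
    case 2
    then show ?thesis using that
      by (intro exI[of _ "-1"]) (simp add: inner_add_right)
  qed (use that in simp)
  have "\<exists>m. v \<bullet> (x + y) = of_int m \<and> v - of_int m *\<^sub>R (x + y) \<in> unit_roots"
  proof (cases "v \<bullet> x = 0 \<and> v \<bullet> y = 0")
    case True
    then show ?thesis using v by (intro exI[of _ 0]) (simp add: inner_add_right)
  next
    case False
    then show ?thesis
      using *[OF xy(2,3,4)] *[OF xy(3,2)] xy(4) by (auto simp: inner_commute add.commute)
  qed
  then show ?thesis using that xy(1) by blast
qed

lemma inner_enumerated_Basis:
  assumes "bij_betw e {..<l} Basis" "i < l" "j < l"
  shows "e i \<bullet> e j = (if i = j then 1 else 0)"
proof -
  have "e i \<in> Basis" "e j \<in> Basis" "e i = e j \<longleftrightarrow> i = j"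
    using assms by (auto simp: bij_betw_def inj_on_eq_iff)
  then show ?thesis by (simp add: inner_Basis)
qed

lemma standard_roots_eq:
  fixes e :: "nat \<Rightarrow> 'd::euclidean_space"
  assumes e: "bij_betw e {..<l} Basis"
  shows "standard_roots X l e = {0} \<union>
    (case X of B_type \<Rightarrow> unit_roots | C_type \<Rightarrow> (\<lambda>x. 2 *\<^sub>R x) ` unit_roots) \<union> pair_roots"
proof -
  have im: "e ` {..<l} = Basis" using e by (simp add: bij_betw_def)
  have inn: "e i \<bullet> e j = (if i = j then 1 else 0)" if "i < l" "j < l" for i j
    using inner_enumerated_Basis[OF e that] .
  have U: "unit_roots = (\<Union>i<l. {e i, - e i})"
    unfolding unit_roots_def im[symmetric] by auto
  have "(\<Union>i<l. \<Union>j<i. {e i + e j, e i - e j, - e i + e j, - e i - e j}) = pair_roots"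
  proof
    show "(\<Union>i<l. \<Union>j<i. {e i + e j, e i - e j, - e i + e j, - e i - e j}) \<subseteq> pair_roots"
    proof clarify
      fix i j x assume ij: "i < l" "j < i" 
        and x: "x \<in> {e i + e j, e i - e j, - e i + e j, - e i - e j}"
      then obtain y z where "x = y + z" "y \<in> {e i, - e i}" "z \<in> {e j, - e j}" by force
      moreover have "y \<in> unit_roots" "z \<in> unit_roots" "y \<bullet> z = 0"
        using calculation ij inn[of i j] unfolding U by auto
      ultimately show "x \<in> pair_roots"
        unfolding pair_roots_def by blast
    qed
    show "pair_roots \<subseteq> (\<Union>i<l. \<Union>j<i. {e i + e j, e i - e j, - e i + e j, - e i - e j})"
    proof
      fix x :: 'd assume "x \<in> pair_roots"
      then obtain y z i j where yz: "x = y + z" "y \<bullet> z = 0" "i < l" "y \<in> {e i, - e i}" "j < l" "z \<in> {e j, - e j}"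
        unfolding pair_roots_def U by blast
      then have "i \<noteq> j" using inn[of i j] by auto
      then have ij: "i < j \<or> j < i" by auto
      have "x \<in> {e i + e j, e i - e j, - e i + e j, - e i - e j}" "x \<in> {e j + e i, e j - e i, - e j + e i, - e j - e i}"
        using yz by auto
      with ij yz(3,5) show "x \<in> (\<Union>i<l. \<Union>j<i. {e i + e j, e i - e j, - e i + e j, - e i - e j})"
        by (meson UN_I lessThan_iff)
    qed
  qed
  moreover have "(\<Union>i<l. case X of B_type \<Rightarrow> {e i, - e i} | C_type \<Rightarrow> {2 *\<^sub>R e i, - (2 *\<^sub>R e i)}) =
      (case X of B_type \<Rightarrow> unit_roots | C_type \<Rightarrow> (\<lambda>x. 2 *\<^sub>R x) ` unit_roots)"
    unfolding U image_UN by (cases X) simp_all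
  ultimately show ?thesis by (simp only: standard_roots_def)
qed

lemma short_long_roots:
  assumes "Rd = {0} \<union> A \<union> B" "A \<noteq> {}" "0 < p" "p < q"
    and "\<And>x. x \<in> A \<Longrightarrow> norm x = p" "\<And>x. x \<in> B \<Longrightarrow> norm x = q"
  shows "short_roots Rd = A" "long_roots Rd = B"
proof -
  have 0: "0 \<notin> A" "0 \<notin> B" using assms(3,4) assms(5)[of 0] assms(6)[of 0] by auto
  obtain a where a: "a \<in> A" using assms(2) by blast
  have "norm x \<le> norm y" if "x \<in> A" "y \<in> A \<union> B" for x y
    using that assms(4,5,6) by force
  moreover have "\<not> norm x \<le> norm a" if "x \<in> B" for x
    using a that assms(4,5,6) by force
  ultimately show s: "short_roots Rd = A"
    unfolding short_roots_def assms(1) using 0 a by blast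
  have "A \<inter> B = {}" using assms(4,5,6) by force
  then show "long_roots Rd = B"
    unfolding long_roots_def s using 0 assms(1) by blast
qed

lemma exists_root_system:
  fixes l :: nat
  assumes l: "DIM('d::euclidean_space) = l" "2 \<le> l"
  obtains Rd :: "'d::euclidean_space set" where "finite_root_system_of_type X l Rd"
    "short_roots Rd = (case X of B_type \<Rightarrow> unit_roots | C_type \<Rightarrow> pair_roots)"
    "long_roots Rd = (case X of B_type \<Rightarrow> pair_roots | C_type \<Rightarrow> (\<lambda>x. 2 *\<^sub>R x) ` unit_roots)"
proof -
  obtain e :: "nat \<Rightarrow> 'd" where e: "bij_betw e {..<l} Basis"
    using ex_bij_betw_nat_finite[of "Basis :: 'd set"] l by (auto simp: atLeast0LessThan)
  let ?Rd = "standard_roots X l e"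
  note Rd = standard_roots_eq[OF e, of X]
  have inn: "e i \<bullet> e j = (if i = j then 1 else 0)" if "i < l" "j < l" for i j
    using inner_enumerated_Basis[OF e that] .
  have sp: "Basis \<subseteq> span ?Rd"
  proof
    fix b :: 'd assume b: "b \<in> Basis"
    have "b \<in> ?Rd \<or> 2 *\<^sub>R b \<in> ?Rd" unfolding Rd using b by (cases X) (auto simp: unit_roots_def)
    then have "b \<in> span ?Rd \<or> (1/2) *\<^sub>R (2 *\<^sub>R b) \<in> span ?Rd" by (metis span_base span_scale)
    then show "b \<in> span ?Rd" by simp
  qed
  have "UNIV \<subseteq> span ?Rd" using span_minimal[OF sp subspace_span] by simp
  then have "span ?Rd = UNIV" by blast
  then have "finite_root_system_of_type X l ?Rd"
    unfolding finite_root_system_of_type_def using inn by (intro conjI exI[of _ e] exI[of _ 1]) auto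
  moreover have n1: "norm x = 1" if "x \<in> unit_roots" for x :: 'd
    using inner_self_unit_root[OF that] by (simp add: norm_eq_sqrt_inner)
  have n2: "norm x = sqrt 2" if "x \<in> pair_roots" for x :: 'd
    using inner_self_pair_root[OF that] by (simp add: norm_eq_sqrt_inner)
  have ne: "(unit_roots :: 'd set) \<noteq> {}" by (auto simp: unit_roots_def)
  have "e 1 + e 0 \<in> pair_roots"
    using inn[of 1 0] e l(2) unfolding pair_roots_def unit_roots_def
    by (fastforce simp: bij_betw_def)
  then have np: "(pair_roots :: 'd set) \<noteq> {}" by blast
  have s2: "sqrt 2 < (2::real)" by (rule real_less_lsqrt) simp_all
  have "short_roots ?Rd = (case X of B_type \<Rightarrow> unit_roots | C_type \<Rightarrow> pair_roots)"
      "long_roots ?Rd = (case X of B_type \<Rightarrow> pair_roots | C_type \<Rightarrow> (\<lambda>x. 2 *\<^sub>R x) ` unit_roots)"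
  proof (atomize(full), cases X)
    case B_type
    have "?Rd = {0} \<union> unit_roots \<union> pair_roots" unfolding Rd by (simp add: B_type)
    from short_long_roots[OF this ne, of 1 "sqrt 2"] 
    show "short_roots ?Rd = (case X of B_type \<Rightarrow> unit_roots | C_type \<Rightarrow> pair_roots) \<and>
      long_roots ?Rd = (case X of B_type \<Rightarrow> pair_roots | C_type \<Rightarrow> (\<lambda>x. 2 *\<^sub>R x) ` unit_roots)"
      by (simp add: B_type n1 n2)
  next
    case C_type
    have "?Rd = {0} \<union> pair_roots \<union> (\<lambda>x. 2 *\<^sub>R x) ` unit_roots" unfolding Rd by (auto simp: C_type)
    moreover have "norm x = 2" if "x \<in> (\<lambda>x. 2 *\<^sub>R x) ` unit_roots" for x :: 'd
      using that n1 by auto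
    ultimately
    show "short_roots ?Rd = (case X of B_type \<Rightarrow> unit_roots | C_type \<Rightarrow> pair_roots) \<and>
      long_roots ?Rd = (case X of B_type \<Rightarrow> pair_roots | C_type \<Rightarrow> (\<lambda>x. 2 *\<^sub>R x) ` unit_roots)"
      using short_long_roots[OF _ np _ s2 n2] by (simp add: C_type)
  qed
  ultimately show ?thesis using that by blast
qed

section \<open>Extended affine root systems that are not minimal\<close>

lemma nonisotropic_ears:
  "nonisotropic (ears Rd S1 S2) =
     {(v, (x, y), 0) | v x y. v \<in> short_roots Rd \<and> x \<in> S1 \<and> y \<in> int_span S2} \<union>
     {(v, (2 *\<^sub>R x, y), 0) | v x y. v \<in> long_roots Rd \<and> x \<in> int_span S1 \<and> y \<in> S2}"
proof -
  have "v \<noteq> 0" if "v \<in> short_roots Rd \<or> v \<in> long_roots Rd" for v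
    using that by (auto simp: short_roots_def long_roots_def)
  then show ?thesis
    unfolding nonisotropic_def ears_def by (auto simp: form_def)
qed

lemma reflection_root:
  assumes "v \<noteq> 0" "2 * (w \<bullet> v) = k * (v \<bullet> v)"
  shows "reflection (v, (x, y), 0) (w, (x', y'), 0) =
    (w - k *\<^sub>R v, (x' - k *\<^sub>R x, y' - k *\<^sub>R y), 0)"
proof -
  have "2 * (w \<bullet> v) / (v \<bullet> v) = k" using assms by (simp add: field_simps)
  then show ?thesis by (simp add: reflection_apply[OF assms(1)])
qed

text \<open>The set \<open>Q\<close> consists of the short roots over the coset of \<open>p + q + r\<close>. Reflections in short roots change
  the component in the first lattice by an even multiple of a lattice vector, and reflections in long roots by
  an integer multiple of a vector in twice the first lattice, so both stay in \<open>Q\<close>.\<close>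

lemma not_minimal_ears_B:
  fixes F1 :: "'b::euclidean_space set set" and F2 :: "'c::euclidean_space set set"
    and Rd :: "'d::euclidean_space set" and p q r :: 'b
  assumes Rd: "short_roots Rd = unit_roots" "long_roots Rd = pair_roots"
    and F1: "support_family F1" "has_cube F1 p q r" and F2: "support_family F2"
  shows "\<not> minimal (ears Rd (semilattice_of F1) (semilattice_of F2))"
proof -
  let ?R = "ears Rd (semilattice_of F1) (semilattice_of F2)"
  define Q where "Q = {(v :: 'd, (x :: 'b, y :: 'c), 0 :: ('b \<times> 'c) \<Rightarrow>\<^sub>L real) | v x y. v \<in> unit_roots \<and>
    x \<in> int_lattice \<and> odd_support x = {p, q, r} \<and> y \<in> int_lattice}"
  have N: "nonisotropic ?R =
     {(v, (x, y), 0) | v x y. v \<in> unit_roots \<and> x \<in> semilattice_of F1 \<and> y \<in> int_lattice} \<union>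
     {(v, (2 *\<^sub>R x, y), 0) | v x y. v \<in> pair_roots \<and> x \<in> int_lattice \<and> y \<in> semilattice_of F2}"
    unfolding nonisotropic_ears Rd int_span_semilattice_of[OF F1(1)] int_span_semilattice_of[OF F2] ..
  have nz: "v \<noteq> 0" if "v \<in> unit_roots \<or> v \<in> pair_roots" for v :: 'd
    using that inner_self_unit_root inner_self_pair_root by fastforce
  have cube: "{p, q, r} \<in> F1" using F1(2) by (auto simp: has_cube_def)
  then have cubeI: "z \<in> semilattice_of F1" if "z \<in> int_lattice" "odd_support z = {p, q, r}" for z
    using that by (simp add: semilattice_of_def)
  have QI: "(v, (x, y), 0) \<in> Q"
    if "v \<in> unit_roots" "x \<in> int_lattice" "odd_support x = {p, q, r}" "y \<in> int_lattice" for v x y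
    unfolding Q_def mem_Collect_eq using that by (intro exI conjI) (rule refl | assumption)+
  have QE: thesis if "\<beta> \<in> Q" "\<And>v x y. \<beta> = (v, (x, y), 0) \<Longrightarrow> v \<in> unit_roots \<Longrightarrow> x \<in> int_lattice \<Longrightarrow>
      odd_support x = {p, q, r} \<Longrightarrow> y \<in> int_lattice \<Longrightarrow> thesis" for \<beta> thesis
    using that(1) unfolding Q_def mem_Collect_eq by (elim exE conjE) (rule that(2))
  have NI: "(v, (x, y), 0) \<in> nonisotropic ?R"
    if "v \<in> unit_roots" "x \<in> semilattice_of F1" "y \<in> int_lattice" for v x y
    unfolding N Un_iff mem_Collect_eq using that by (intro disjI1 exI conjI) (rule refl | assumption)+
  have NE: thesis if "\<gamma> \<in> nonisotropic ?R"
    "\<And>w x y. \<gamma> = (w, (x, y), 0) \<Longrightarrow> w \<in> unit_roots \<Longrightarrow> x \<in> int_lattice \<Longrightarrow> y \<in> int_lattice \<Longrightarrow> thesis"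
    "\<And>w x y. \<gamma> = (w, (2 *\<^sub>R x, y), 0) \<Longrightarrow> w \<in> pair_roots \<Longrightarrow> x \<in> int_lattice \<Longrightarrow> y \<in> int_lattice \<Longrightarrow> thesis"
    for \<gamma> thesis
    using that(1) unfolding N Un_iff mem_Collect_eq
    by (elim disjE exE conjE) (erule that(2) that(3); (assumption | erule semilattice_of_in_int_lattice))+
  show ?thesis
  proof (rule not_minimal_if_redundant[where Q = Q and \<alpha> = "(SOME b. b \<in> Basis, (\<Sum>{p, q, r}, 0), 0)"])
    show "\<exists>v \<delta>. \<gamma> = (v, \<delta>, 0) \<and> v \<noteq> 0" if "\<gamma> \<in> nonisotropic ?R" for \<gamma>
      by (rule NE[OF that]) (use nz in blast)+
    have PB: "{p, q, r} \<subseteq> Basis" using F1(1) cube by (auto simp: support_family_def)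
    have "\<Sum>{p, q, r} \<in> int_lattice" "odd_support (\<Sum>{p, q, r}) = {p, q, r}"
      by (rule sum_in_int_lattice[OF order_trans[OF PB Basis_subset_int_lattice]], rule odd_support_sum[OF PB])
    moreover have "(SOME b. b \<in> Basis) \<in> (unit_roots :: 'd set)"
      by (simp add: unit_roots_def some_in_eq)
    ultimately show "(SOME b. b \<in> Basis, (\<Sum>{p, q, r}, 0), 0) \<in> Q"
      by (intro QI zero_in_int_lattice)
    show "Q \<subseteq> nonisotropic ?R"
      by (rule subsetI, erule QE) (simp only: NI cubeI)
  next
    fix \<beta> \<gamma> assume \<beta>Q: "\<beta> \<in> Q" and \<gamma>: "\<gamma> \<in> nonisotropic ?R"
    obtain v x y where \<beta>: "\<beta> = (v, (x, y), 0)" "v \<in> unit_roots" "x \<in> int_lattice"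
      "odd_support x = {p, q, r}" "y \<in> int_lattice" using \<beta>Q by (rule QE)
    from \<gamma> consider w x' y' where "\<gamma> = (w, (x', y'), 0)" "w \<in> unit_roots" "x' \<in> int_lattice" "y' \<in> int_lattice"
      | w x' y' where "\<gamma> = (w, (2 *\<^sub>R x', y'), 0)" "w \<in> pair_roots" "x' \<in> int_lattice" "y' \<in> int_lattice"
      by (rule NE)
    then show "reflection \<gamma> \<beta> \<in> Q"
    proof cases
      case 1
      obtain m where m: "v \<bullet> w = of_int m" "v - (2 * of_int m) *\<^sub>R w \<in> unit_roots"
        using reflect_unit_in_unit[OF \<beta>(2) 1(2)] .
      have "reflection \<gamma> \<beta> = (v - (2 * of_int m) *\<^sub>R w, (x - (2 * of_int m) *\<^sub>R x', y - (2 * of_int m) *\<^sub>R y'), 0)"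
        unfolding \<beta>(1) 1(1) by (rule reflection_root) (use 1 m nz inner_self_unit_root in auto)
      then show ?thesis
        using QI[OF m(2)] \<beta>(4) odd_support_shift[OF \<beta>(3) 1(3), of m] odd_support_shift(1)[OF \<beta>(5) 1(4), of m]
        by (simp only:)
    next
      case 2
      obtain m where m: "v \<bullet> w = of_int m" "v - of_int m *\<^sub>R w \<in> unit_roots"
        using reflect_unit_in_pair[OF \<beta>(2) 2(2)] .
      have "reflection \<gamma> \<beta> = (v - of_int m *\<^sub>R w, (x - of_int m *\<^sub>R (2 *\<^sub>R x'), y - of_int m *\<^sub>R y'), 0)"
        unfolding \<beta>(1) 2(1) by (rule reflection_root) (use 2 m nz inner_self_pair_root in auto)
      moreover have "of_int m *\<^sub>R (2 *\<^sub>R x') = (2 * of_int m) *\<^sub>R x'" by simp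
      ultimately show ?thesis
        using QI[OF m(2)] \<beta>(4) odd_support_shift[OF \<beta>(3) 2(3), of m]
          int_lattice_diff[OF \<beta>(5) int_lattice_scale[OF 2(4), of m]]
        by (simp only:)
    qed
  next
    fix \<beta> assume \<beta>Q: "\<beta> \<in> Q"
    obtain v x y where \<beta>: "\<beta> = (v, (x, y), 0)" "v \<in> unit_roots" "x \<in> int_lattice"
      "odd_support x = {p, q, r}" "y \<in> int_lattice" using \<beta>Q by (rule QE)
    obtain a b c where abc: "x = a + b + c"
      "{0, a, b, c, a + b, a + c, b + c} \<subseteq> semilattice_of F1 - {z. odd_support z = {p, q, r}}"
      using cube_decomposition[OF F1 \<beta>(3,4)] .
    have mem: "(v, (z, y'), 0) \<in> nonisotropic ?R - Q"
      if "z \<in> semilattice_of F1 - {z. odd_support z = {p, q, r}}" "y' \<in> int_lattice" for z y'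
    proof
      show "(v, (z, y'), 0) \<in> nonisotropic ?R" using NI[OF \<beta>(2)] that by blast
      show "(v, (z, y'), 0) \<notin> Q" using that(1) by (auto elim!: QE)
    qed
    show "\<exists>v a b c. \<beta> = (v, a + b + c, 0) \<and>
      {(v, 0, 0), (v, a, 0), (v, b, 0), (v, c, 0), (v, a + b, 0), (v, a + c, 0), (v, b + c, 0)}
        \<subseteq> nonisotropic ?R - Q"
    proof (intro exI conjI)
      show "\<beta> = (v, (a, y) + (b, 0) + (c, 0), 0)" by (simp add: \<beta>(1) abc(1))
      show "{(v, 0, 0), (v, (a, y), 0), (v, (b, 0), 0), (v, (c, 0), 0), (v, (a, y) + (b, 0), 0),
          (v, (a, y) + (c, 0), 0), (v, (b, 0) + (c, 0), 0)} \<subseteq> nonisotropic ?R - Q"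
        unfolding zero_prod_def add_Pair add_0_right insert_subset
        by (intro conjI mem empty_subsetI zero_in_int_lattice \<beta>(5) subsetD[OF abc(2)]) simp_all
    qed
  qed
qed

text \<open>Here \<open>Q\<close> consists of the long roots \<open>2 v\<close> over the coset of \<open>p + q + r\<close> in the second lattice. The factor
  \<open>2\<close> makes the integral multiple in \<open>reflect_unit_in_pair\<close> even, so that the short roots, whose component in the
  second lattice is arbitrary, preserve the coset as well.\<close>

lemma not_minimal_ears_C:
  fixes F1 :: "'b::euclidean_space set set" and F2 :: "'c::euclidean_space set set"
    and Rd :: "'d::euclidean_space set" and p q r :: 'c
  assumes Rd: "short_roots Rd = pair_roots" "long_roots Rd = (\<lambda>x. 2 *\<^sub>R x) ` unit_roots"
    and F1: "support_family F1" and F2: "support_family F2" "has_cube F2 p q r"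
  shows "\<not> minimal (ears Rd (semilattice_of F1) (semilattice_of F2))"
proof -
  let ?R = "ears Rd (semilattice_of F1) (semilattice_of F2)"
  define Q where "Q = {(2 *\<^sub>R v :: 'd, (2 *\<^sub>R x :: 'b, y :: 'c), 0 :: ('b \<times> 'c) \<Rightarrow>\<^sub>L real) | v x y. v \<in> unit_roots \<and>
    x \<in> int_lattice \<and> y \<in> int_lattice \<and> odd_support y = {p, q, r}}"
  have N: "nonisotropic ?R =
     {(v, (x, y), 0) | v x y. v \<in> pair_roots \<and> x \<in> semilattice_of F1 \<and> y \<in> int_lattice} \<union>
     {(v, (2 *\<^sub>R x, y), 0) | v x y. v \<in> (\<lambda>x. 2 *\<^sub>R x) ` unit_roots \<and> x \<in> int_lattice \<and> y \<in> semilattice_of F2}"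
    unfolding nonisotropic_ears Rd int_span_semilattice_of[OF F1] int_span_semilattice_of[OF F2(1)] ..
  have nz: "v \<noteq> 0" if "v \<in> unit_roots \<or> v \<in> pair_roots" for v :: 'd
    using that inner_self_unit_root inner_self_pair_root by fastforce
  then have nz2: "2 *\<^sub>R v \<noteq> 0" if "v \<in> unit_roots" for v :: 'd using that by simp
  have cube: "{p, q, r} \<in> F2" using F2(2) by (auto simp: has_cube_def)
  then have cubeI: "z \<in> semilattice_of F2" if "z \<in> int_lattice" "odd_support z = {p, q, r}" for z
    using that by (simp add: semilattice_of_def)
  have QI: "(2 *\<^sub>R v, (2 *\<^sub>R x, y), 0) \<in> Q"
    if "v \<in> unit_roots" "x \<in> int_lattice" "y \<in> int_lattice" "odd_support y = {p, q, r}" for v x y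
    unfolding Q_def mem_Collect_eq using that by (intro exI conjI) (rule refl | assumption)+
  have QE: thesis if "\<beta> \<in> Q" "\<And>v x y. \<beta> = (2 *\<^sub>R v, (2 *\<^sub>R x, y), 0) \<Longrightarrow> v \<in> unit_roots \<Longrightarrow>
      x \<in> int_lattice \<Longrightarrow> odd_support y = {p, q, r} \<Longrightarrow> y \<in> int_lattice \<Longrightarrow> thesis" for \<beta> thesis
    using that(1) unfolding Q_def mem_Collect_eq by (elim exE conjE) (rule that(2))
  have NI: "(2 *\<^sub>R v, (2 *\<^sub>R x, y), 0) \<in> nonisotropic ?R"
    if "v \<in> unit_roots" "x \<in> int_lattice" "y \<in> semilattice_of F2" for v x y
    unfolding N Un_iff mem_Collect_eq using that by (intro disjI2 exI conjI) (rule refl imageI | assumption)+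
  have NE: thesis if "\<gamma> \<in> nonisotropic ?R"
    "\<And>w x y. \<gamma> = (w, (x, y), 0) \<Longrightarrow> w \<in> pair_roots \<Longrightarrow> x \<in> int_lattice \<Longrightarrow> y \<in> int_lattice \<Longrightarrow> thesis"
    "\<And>w x y. \<gamma> = (2 *\<^sub>R w, (2 *\<^sub>R x, y), 0) \<Longrightarrow> w \<in> unit_roots \<Longrightarrow> x \<in> int_lattice \<Longrightarrow> y \<in> int_lattice \<Longrightarrow> thesis"
    for \<gamma> thesis
    using that(1) unfolding N Un_iff mem_Collect_eq
  proof (elim disjE exE conjE imageE)
    fix v x y
    assume "\<gamma> = (v, (x, y), 0)" "v \<in> pair_roots" "x \<in> semilattice_of F1" "y \<in> int_lattice"
    then show thesis by (intro that(2)) (assumption | erule semilattice_of_in_int_lattice)+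
  next
    fix v x y w
    assume "\<gamma> = (v, (2 *\<^sub>R x, y), 0)" "v = 2 *\<^sub>R w"
      and xy: "x \<in> int_lattice" "y \<in> semilattice_of F2" "w \<in> unit_roots"
    then have "\<gamma> = (2 *\<^sub>R w, (2 *\<^sub>R x, y), 0)" by (simp only:)
    then show thesis using xy by (intro that(3)) (assumption | erule semilattice_of_in_int_lattice)+
  qed
  show ?thesis
  proof (rule not_minimal_if_redundant[where Q = Q and
        \<alpha> = "(2 *\<^sub>R (SOME b. b \<in> Basis), (2 *\<^sub>R 0, \<Sum>{p, q, r}), 0)"])
    show "\<exists>v \<delta>. \<gamma> = (v, \<delta>, 0) \<and> v \<noteq> 0" if "\<gamma> \<in> nonisotropic ?R" for \<gamma>
      by (rule NE[OF that]) (use nz nz2 in blast)+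
    have PB: "{p, q, r} \<subseteq> Basis" using F2(1) cube by (auto simp: support_family_def)
    have "\<Sum>{p, q, r} \<in> int_lattice" "odd_support (\<Sum>{p, q, r}) = {p, q, r}"
      by (rule sum_in_int_lattice[OF order_trans[OF PB Basis_subset_int_lattice]], rule odd_support_sum[OF PB])
    moreover have "(SOME b. b \<in> Basis) \<in> (unit_roots :: 'd set)"
      by (simp add: unit_roots_def some_in_eq)
    ultimately show "(2 *\<^sub>R (SOME b. b \<in> Basis), (2 *\<^sub>R 0, \<Sum>{p, q, r}), 0) \<in> Q"
      by (intro QI zero_in_int_lattice)
    show "Q \<subseteq> nonisotropic ?R"
      by (rule subsetI, erule QE) (simp only: NI cubeI)
  next
    fix \<beta> \<gamma> assume \<beta>Q: "\<beta> \<in> Q" and \<gamma>: "\<gamma> \<in> nonisotropic ?R"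
    obtain v x y where \<beta>: "\<beta> = (2 *\<^sub>R v, (2 *\<^sub>R x, y), 0)" "v \<in> unit_roots" "x \<in> int_lattice"
      "odd_support y = {p, q, r}" "y \<in> int_lattice" using \<beta>Q by (rule QE)
    from \<gamma> consider w x' y' where "\<gamma> = (w, (x', y'), 0)" "w \<in> pair_roots" "x' \<in> int_lattice" "y' \<in> int_lattice"
      | w x' y' where "\<gamma> = (2 *\<^sub>R w, (2 *\<^sub>R x', y'), 0)" "w \<in> unit_roots" "x' \<in> int_lattice" "y' \<in> int_lattice"
      by (rule NE)
    then show "reflection \<gamma> \<beta> \<in> Q"
    proof cases
      case 1
      obtain m where m: "v \<bullet> w = of_int m" "v - of_int m *\<^sub>R w \<in> unit_roots"
        using reflect_unit_in_pair[OF \<beta>(2) 1(2)] .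
      have "reflection \<gamma> \<beta> = (2 *\<^sub>R v - (2 * of_int m) *\<^sub>R w,
          (2 *\<^sub>R x - (2 * of_int m) *\<^sub>R x', y - (2 * of_int m) *\<^sub>R y'), 0)"
        unfolding \<beta>(1) 1(1) by (rule reflection_root) (use 1 m nz inner_self_pair_root in auto)
      also have "\<dots> = (2 *\<^sub>R (v - of_int m *\<^sub>R w),
          (2 *\<^sub>R (x - of_int m *\<^sub>R x'), y - (2 * of_int m) *\<^sub>R y'), 0)"
        by (simp add: scaleR_diff_right)
      finally show ?thesis
        using QI[OF m(2)] \<beta>(4) odd_support_shift[OF \<beta>(5) 1(4), of m]
          int_lattice_diff[OF \<beta>(3) int_lattice_scale[OF 1(3), of m]]
        by (simp only:)
    next
      case 2
      obtain m where m: "v \<bullet> w = of_int m" "v - (2 * of_int m) *\<^sub>R w \<in> unit_roots"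
        using reflect_unit_in_unit[OF \<beta>(2) 2(2)] .
      have "reflection \<gamma> \<beta> = (2 *\<^sub>R v - (2 * of_int m) *\<^sub>R (2 *\<^sub>R w),
          (2 *\<^sub>R x - (2 * of_int m) *\<^sub>R (2 *\<^sub>R x'), y - (2 * of_int m) *\<^sub>R y'), 0)"
        unfolding \<beta>(1) 2(1) by (rule reflection_root) (use 2 m nz2 inner_self_unit_root in auto)
      also have "\<dots> = (2 *\<^sub>R (v - (2 * of_int m) *\<^sub>R w),
          (2 *\<^sub>R (x - (2 * of_int m) *\<^sub>R x'), y - (2 * of_int m) *\<^sub>R y'), 0)"
        by (simp add: scaleR_diff_right)
      finally show ?thesis
        using QI[OF m(2)] \<beta>(4) odd_support_shift[OF \<beta>(5) 2(4), of m] odd_support_shift(1)[OF \<beta>(3) 2(3), of m]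
        by (simp only:)
    qed
  next
    fix \<beta> assume \<beta>Q: "\<beta> \<in> Q"
    obtain v x y where \<beta>: "\<beta> = (2 *\<^sub>R v, (2 *\<^sub>R x, y), 0)" "v \<in> unit_roots" "x \<in> int_lattice"
      "odd_support y = {p, q, r}" "y \<in> int_lattice" using \<beta>Q by (rule QE)
    obtain a b c where abc: "y = a + b + c"
      "{0, a, b, c, a + b, a + c, b + c} \<subseteq> semilattice_of F2 - {z. odd_support z = {p, q, r}}"
      using cube_decomposition[OF F2 \<beta>(5,4)] .
    have mem: "(2 *\<^sub>R v, (2 *\<^sub>R x', z), 0) \<in> nonisotropic ?R - Q"
      if "z \<in> semilattice_of F2 - {z. odd_support z = {p, q, r}}" "x' \<in> int_lattice" for z x'
    proof
      show "(2 *\<^sub>R v, (2 *\<^sub>R x', z), 0) \<in> nonisotropic ?R" using NI[OF \<beta>(2)] that by blast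
      show "(2 *\<^sub>R v, (2 *\<^sub>R x', z), 0) \<notin> Q" using that(1) by (auto elim!: QE)
    qed
    show "\<exists>v a b c. \<beta> = (v, a + b + c, 0) \<and>
      {(v, 0, 0), (v, a, 0), (v, b, 0), (v, c, 0), (v, a + b, 0), (v, a + c, 0), (v, b + c, 0)}
        \<subseteq> nonisotropic ?R - Q"
    proof (intro exI conjI)
      show "\<beta> = (2 *\<^sub>R v, (2 *\<^sub>R x, a) + (2 *\<^sub>R 0, b) + (2 *\<^sub>R 0, c), 0)" by (simp add: \<beta>(1) abc(1))
      have "{(2 *\<^sub>R v, (2 *\<^sub>R 0, 0), 0), (2 *\<^sub>R v, (2 *\<^sub>R x, a), 0), (2 *\<^sub>R v, (2 *\<^sub>R 0, b), 0),
          (2 *\<^sub>R v, (2 *\<^sub>R 0, c), 0), (2 *\<^sub>R v, (2 *\<^sub>R x, a + b), 0), (2 *\<^sub>R v, (2 *\<^sub>R x, a + c), 0),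
          (2 *\<^sub>R v, (2 *\<^sub>R 0, b + c), 0)} \<subseteq> nonisotropic ?R - Q"
        unfolding insert_subset
        by (intro conjI mem empty_subsetI zero_in_int_lattice \<beta>(3) subsetD[OF abc(2)]) simp_all
      then show "{(2 *\<^sub>R v, 0, 0), (2 *\<^sub>R v, (2 *\<^sub>R x, a), 0), (2 *\<^sub>R v, (2 *\<^sub>R 0, b), 0),
          (2 *\<^sub>R v, (2 *\<^sub>R 0, c), 0), (2 *\<^sub>R v, (2 *\<^sub>R x, a) + (2 *\<^sub>R 0, b), 0),
          (2 *\<^sub>R v, (2 *\<^sub>R x, a) + (2 *\<^sub>R 0, c), 0),
          (2 *\<^sub>R v, (2 *\<^sub>R 0, b) + (2 *\<^sub>R 0, c), 0)} \<subseteq> nonisotropic ?R - Q"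
        unfolding zero_prod_def add_Pair scaleR_zero_right add_0_right .
    qed
  qed
qed

theorem proposition41:
  fixes X :: root_type and l \<nu> t m1 m2 :: nat
  assumes type: "(X = B_type \<and> 2 \<le> l) \<or> (X = C_type \<and> 3 \<le> l)"
    and m1: "7 \<le> t + 4" "t + 4 \<le> m1" "m1 \<le> 2 ^ t - 1"
    and m2: "7 \<le> \<nu> - t + 4" "\<nu> - t + 4 \<le> m2" "m2 \<le> 2 ^ (\<nu> - t) - 1"
    and dims: "DIM('d::euclidean_space) = l" "DIM('b::euclidean_space) = t"
      "DIM('c::euclidean_space) = \<nu> - t"
  shows "\<exists>(Rd :: 'd set) (S1 :: 'b set) (S2 :: 'c set).
    ears_datum X l Rd S1 S2 \<and>
    ind S1 = (case X of B_type \<Rightarrow> m1 | C_type \<Rightarrow> 2 ^ t - 1) \<and>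
    ind S2 = (if X = B_type \<and> 3 \<le> l then 2 ^ (\<nu> - t) - 1 else m2) \<and>
    \<not> minimal (ears Rd S1 S2)"
proof -
  have l: "2 \<le> l" using type by auto
  obtain Rd :: "'d set" where Rd: "finite_root_system_of_type X l Rd"
    "short_roots Rd = (case X of B_type \<Rightarrow> unit_roots | C_type \<Rightarrow> pair_roots)"
    "long_roots Rd = (case X of B_type \<Rightarrow> pair_roots | C_type \<Rightarrow> (\<lambda>x. 2 *\<^sub>R x) ` unit_roots)"
    using exists_root_system[OF dims(1) l] .
  have b: "3 \<le> DIM('b)" "DIM('b) + 4 \<le> m1" "m1 \<le> 2 ^ DIM('b) - 1" using m1 dims(2) by simp_all
  have c: "3 \<le> DIM('c)" "DIM('c) + 4 \<le> m2" "m2 \<le> 2 ^ DIM('c) - 1" using m2 dims(3) by simp_all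
  obtain F1 :: "'b set set" and p1 q1 r1
    where F1: "support_family F1" "card F1 = m1 + 1" "has_cube F1 p1 q1 r1"
    using exists_support_family[OF b] .
  obtain F2 :: "'c set set" and p2 q2 r2
    where F2: "support_family F2" "card F2 = m2 + 1" "has_cube F2 p2 q2 r2"
    using exists_support_family[OF c] .
  show ?thesis
  proof (cases X)
    case B_type
    define G :: "'c set set" where "G = (if 3 \<le> l then Pow Basis else F2)"
    have G: "support_family G" using F2(1) by (simp add: G_def support_family_Pow)
    have "ears_datum X l Rd (semilattice_of F1) (semilattice_of G)"
      using Rd(1) semilattice_set_semilattice_of[OF F1(1)] semilattice_set_semilattice_of[OF G]
      by (simp add: ears_datum_def B_type G_def lattice_set_Pow)
    moreover have "ind (semilattice_of F1) = m1"
      by (simp add: ind_semilattice_of F1)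
    moreover have "ind (semilattice_of G) = (if 3 \<le> l then 2 ^ (\<nu> - t) - 1 else m2)"
      using ind_Pow[where 'a = 'c] by (simp add: G_def ind_semilattice_of F2 dims(3))
    moreover have "\<not> minimal (ears Rd (semilattice_of F1) (semilattice_of G))"
      using Rd(2,3) by (intro not_minimal_ears_B[OF _ _ F1(1,3) G]) (simp_all add: B_type)
    ultimately show ?thesis
      by (intro exI[of _ Rd] exI[of _ "semilattice_of F1"] exI[of _ "semilattice_of G"]) (simp add: B_type)
  next
    case C_type
    let ?G = "Pow Basis :: 'b set set"
    have "ears_datum X l Rd (semilattice_of ?G) (semilattice_of F2)"
      using Rd(1) semilattice_set_semilattice_of[OF F2(1)]
        semilattice_set_semilattice_of[OF support_family_Pow]
      by (simp add: ears_datum_def C_type lattice_set_Pow)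
    moreover have "ind (semilattice_of ?G) = 2 ^ t - 1"
      by (simp only: ind_Pow dims(2))
    moreover have "ind (semilattice_of F2) = m2"
      by (simp add: ind_semilattice_of F2)
    moreover have "\<not> minimal (ears Rd (semilattice_of ?G) (semilattice_of F2))"
      using Rd(2,3) by (intro not_minimal_ears_C[OF _ _ support_family_Pow F2(1,3)]) (simp_all add: C_type)
    ultimately show ?thesis
      by (intro exI[of _ Rd] exI[of _ "semilattice_of ?G"] exI[of _ "semilattice_of F2"]) (simp add: C_type)
  qed
qed

end
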